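(* Let $n\geq 2$ and $m\geq 1$. Then $$\operatorname{depth}(S_{n,m}/I(\mathcal{P}_{n,m}))\leq\left\lceil\frac{n}{3}\right\rceil\left\lceil\frac{m}{3}\right\rceil\quad\text{and}\quad \operatorname{sdepth}(S_{n,m}/I(\mathcal{P}_{n,m})) \leq\left\lceil\frac{n}{3}\right\rceil\left\lceil\frac{m}{3}\right\rceil.$$
   Context: $K$ is a field. For a finite simple graph $G$ whose vertices are the variables of a polynomial ring over $K$, the edge ideal $I(G)$ is the squarefree monomial ideal generated by all products $uv$ with $\{u,v\}\in E(G)$. $P_n$ is the path on $n$ vertices ($P_1$ is a single vertex with no edges). The strong product $G_1\boxtimes G_2$ has vertex set $V(G_1)\times V(G_2)$, and two distinct vertices $(v_1,u_1),(v_2,u_2)$ are adjacent iff each coordinate pair is equal or adjacent ($v_1=v_2$ or $v_1v_2\in E(G_1)$, and $u_1=u_2$ or $u_1u_2\in E(G_2)$). Put $\mathcal{P}_{n,m}:=P_n\boxtimes P_m$, with vertices labelled by variables $x_{ij}$ ($1\le i\le n$, $1\le j\le m$), so that distinct $x_{ij},x_{kl}$ are adjacent iff $|i-k|\le 1$ and $|j-l|\le 1$. $S_{n,m}:=K[x_{ij}:1\le i\le n,\ 1\le j\le m]$. Depth is taken with respect to the graded maximal ideal generated by all the variables. Stanley depth: let $S=K[x_1,\dots,x_N]$ and $M$ a finitely generated $\mathbb{Z}^N$-graded $S$-module. A Stanley decomposition $\mathcal{D}$ of $M$ is a finite direct sum of $K$-vector spaces $M=\bigoplus_{i=1}^r w_iK[A_i]$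 with $w_i\in M$ homogeneous, $A_i\subseteq\{x_1,\dots,x_N\}$, where $w_iK[A_i]$ (the $K$-span of all $w_iu$, $u$ a monomial in $K[A_i]$) is a free $K[A_i]$-module. $\operatorname{sdepth}(\mathcal{D})=\min_i|A_i|$ and $\operatorname{sdepth}(M)$ is the maximum of $\operatorname{sdepth}(\mathcal{D})$ over all Stanley decompositions $\mathcal{D}$ of $M$. *)

theory Defs
  imports
    "HOL-Algebra.QuotRing"
    "HOL-Algebra.Module"
    "HOL-Library.Poly_Mapping"
    "HOL-Library.Extended_Nat"
    "Graph_Theory.Pair_Digraph"
begin

section \<open>Polynomial rings in a set of variables\<close>

text \<open>
  A monomial is a finitely supported exponent vector, a polynomial a finitely supported family of
  coefficients.  For a set \<open>X\<close> of variables, \<open>poly_ring X\<close> is \<open>K[X]\<close>, where the field \<open>K\<close>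
  is the coefficient type.  For \<open>A \<subseteq> X\<close> the ring \<open>K[A]\<close> is literally a subring of \<open>K[X]\<close>.
\<close>

type_synonym ('v, 'k) mpoly = "('v \<Rightarrow>\<^sub>0 nat) \<Rightarrow>\<^sub>0 'k"

definition poly_ring :: "'v set \<Rightarrow> ('v, 'k::field) mpoly ring" where
  "poly_ring X =
    \<lparr>carrier = {p. \<forall>t \<in> Poly_Mapping.keys p. Poly_Mapping.keys t \<subseteq> X},
     monoid.mult = (*), one = 1, zero = 0, add = (+)\<rparr>"

definition pvar :: "'v \<Rightarrow> ('v, 'k::field) mpoly" where
  "pvar x = Poly_Mapping.single (Poly_Mapping.single x 1) 1"

definition max_ideal :: "'v set \<Rightarrow> ('v, 'k::field) mpoly set" where
  "max_ideal X = genideal (poly_ring X) (pvar ` X)"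

lemma poly_ring_cring: "cring (poly_ring X :: ('v, 'k::field) mpoly ring)"
proof -
  have add: "p + q \<in> carrier (poly_ring X)" and mult: "p * q \<in> carrier (poly_ring X)"
    if pq: "p \<in> carrier (poly_ring X)" "q \<in> carrier (poly_ring X)" for p q :: "('v, 'k) mpoly"
  proof -
    show "p + q \<in> carrier (poly_ring X)"
      using pq Poly_Mapping.keys_add[of p q] by (fastforce simp: poly_ring_def)
    show "p * q \<in> carrier (poly_ring X)"
    proof -
      have "Poly_Mapping.keys t \<subseteq> X" if t: "t \<in> Poly_Mapping.keys (p * q)" for t
      proof -
        obtain a b where "t = a + b" "a \<in> Poly_Mapping.keys p" "b \<in> Poly_Mapping.keys q"
          using t Poly_Mapping.keys_mult[of p q] by blast
        then show ?thesis
          using pq Poly_Mapping.keys_add[of a b] by (fastforce simp: poly_ring_def)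
      qed
      then show ?thesis
        by (simp add: poly_ring_def)
    qed
  qed
  have neg: "- p \<in> carrier (poly_ring X)" if "p \<in> carrier (poly_ring X)" for p :: "('v, 'k) mpoly"
    using that by (simp add: poly_ring_def)
  have zero: "(0 :: ('v, 'k) mpoly) \<in> carrier (poly_ring X)"
    and one: "(1 :: ('v, 'k) mpoly) \<in> carrier (poly_ring X)"
    by (simp_all add: poly_ring_def)
  have ops: "p \<oplus>\<^bsub>poly_ring X\<^esub> q = p + q" "p \<otimes>\<^bsub>poly_ring X\<^esub> q = p * q"
    "\<zero>\<^bsub>poly_ring X\<^esub> = (0 :: ('v, 'k) mpoly)" "\<one>\<^bsub>poly_ring X\<^esub> = (1 :: ('v, 'k) mpoly)"
    for p q :: "('v, 'k) mpoly"
    by (simp_all add: poly_ring_def)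
  show ?thesis
  proof (rule cringI)
    show "abelian_group (poly_ring X :: ('v, 'k) mpoly ring)"
    proof (rule abelian_groupI)
      fix p :: "('v, 'k) mpoly"
      assume "p \<in> carrier (poly_ring X)"
      then show "\<exists>q \<in> carrier (poly_ring X). q \<oplus>\<^bsub>poly_ring X\<^esub> p = \<zero>\<^bsub>poly_ring X\<^esub>"
        using neg by (intro bexI[of _ "- p"]) (simp_all add: ops)
    qed (simp_all add: ops add zero ac_simps)
    show "comm_monoid (poly_ring X :: ('v, 'k) mpoly ring)"
      by (rule comm_monoidI) (simp_all add: ops mult one ac_simps)
  qed (simp add: ops distrib_right)
qed

section \<open>Paths, strong products and edge ideals\<close>

text \<open>
  A finite simple graph is a \<^locale>\<open>pair_graph\<close>: a finite loop-free symmetric digraph, in which an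
  edge \<open>{u, v}\<close> is represented by the two arcs \<open>(u, v)\<close> and \<open>(v, u)\<close>.
\<close>

definition path_graph :: "nat \<Rightarrow> nat pair_pre_digraph" where
  "path_graph n =
    \<lparr>pverts = {1..n}, parcs = {(i, j) \<in> {1..n} \<times> {1..n}. j = i + 1 \<or> i = j + 1}\<rparr>"

definition strong_product ::
  "'a pair_pre_digraph \<Rightarrow> 'b pair_pre_digraph \<Rightarrow> ('a \<times> 'b) pair_pre_digraph" (infixr \<open>\<boxtimes>\<close> 70) where
  "G \<boxtimes> H =
    \<lparr>pverts = pverts G \<times> pverts H,
     parcs = {((v1, u1), (v2, u2)).
       (v1, u1) \<in> pverts G \<times> pverts H \<and> (v2, u2) \<in> pverts G \<times> pverts H \<and> (v1, u1) \<noteq> (v2, u2) \<and>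
       (v1 = v2 \<or> (v1, v2) \<in> parcs G) \<and> (u1 = u2 \<or> (u1, u2) \<in> parcs H)}\<rparr>"

definition edge_ideal :: "'v pair_pre_digraph \<Rightarrow> ('v, 'k::field) mpoly set" where
  "edge_ideal G = genideal (poly_ring (pverts G)) {pvar u * pvar v |u v. (u, v) \<in> parcs G}"

lemma pair_graph_path_graph: "pair_graph (path_graph n)"
proof -
  have "parcs (path_graph n) \<subseteq> {1..n} \<times> {1..n}"
    by (auto simp: path_graph_def)
  then have "finite (parcs (path_graph n))"
    by (rule finite_subset) simp
  then show ?thesis
    by unfold_locales (auto simp: path_graph_def symmetric_def sym_def)
qed

lemma pair_graph_strong_product:
  assumes "pair_graph G" "pair_graph H"
  shows "pair_graph (G \<boxtimes> H)"
proof -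
  interpret G: pair_graph G by fact
  interpret H: pair_graph H by fact
  have fin: "finite (pverts G \<times> pverts H)"
    using G.pair_finite_verts H.pair_finite_verts by simp
  have "parcs (G \<boxtimes> H) \<subseteq> (pverts G \<times> pverts H) \<times> (pverts G \<times> pverts H)"
    by (auto simp: strong_product_def)
  then have "finite (parcs (G \<boxtimes> H))"
    using fin by (meson finite_SigmaI finite_subset)
  moreover have "sym (parcs (G \<boxtimes> H))"
    using G.pair_sym_arcs H.pair_sym_arcs
    by (auto simp: strong_product_def symmetric_def sym_def)
  ultimately show ?thesis
    using fin by unfold_locales (auto simp: strong_product_def symmetric_def)
qed

lemma parcs_strong_product_path_graph:
  "((i, j), (k, l)) \<in> parcs (path_graph n \<boxtimes> path_graph m) \<longleftrightarrow>
    (i, j) \<in> {1..n} \<times> {1..m} \<and> (k, l) \<in> {1..n} \<times> {1..m} \<and> (i, j) \<noteq> (k, l) \<and>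
    \<bar>int i - int k\<bar> \<le> 1 \<and> \<bar>int j - int l\<bar> \<le> 1"
  by (auto simp: strong_product_def path_graph_def)

lemma edge_ideal_ideal:
  assumes "pair_graph G"
  shows "ideal (edge_ideal G :: ('v, 'k::field) mpoly set) (poly_ring (pverts G))"
proof -
  interpret G: pair_graph G by fact
  interpret R: cring "poly_ring (pverts G) :: ('v, 'k) mpoly ring" by (rule poly_ring_cring)
  have var: "(pvar u :: ('v, 'k) mpoly) \<in> carrier (poly_ring (pverts G))" if "u \<in> pverts G" for u
    using that by (simp add: poly_ring_def pvar_def)
  have "pvar u * pvar v \<in> carrier (poly_ring (pverts G) :: ('v, 'k) mpoly ring)"
    if "(u, v) \<in> parcs G" for u v
    using R.m_closed[OF var var, of u v] that G.arc_fst_in_verts G.arc_snd_in_verts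
    by (fastforce simp: poly_ring_def)
  then show ?thesis
    unfolding edge_ideal_def by (intro R.genideal_ideal) auto
qed

section \<open>Quotient modules and depth\<close>

text \<open>The \<open>R\<close>-module \<open>R/I\<close>: the scalar \<open>r\<close> acts as multiplication by its class \<open>r + I\<close>.\<close>

definition quot_module :: "('a, 'b) ring_scheme \<Rightarrow> 'a set \<Rightarrow> ('a, 'a set) module" where
  "quot_module R I =
    \<lparr>carrier = carrier (R Quot I), monoid.mult = monoid.mult (R Quot I), one = one (R Quot I),
     zero = zero (R Quot I), add = add (R Quot I),
     smult = (\<lambda>r. monoid.mult (R Quot I) (I +>\<^bsub>R\<^esub> r))\<rparr>"

lemma quot_module_module:
  assumes "cring R" "ideal I R"
  shows "Module.module R (quot_module R I)"
proof -
  interpret R: cring R by fact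
  interpret I: ideal I R by fact
  interpret Q: ring "R Quot I" by (rule I.quotient_is_ring)
  interpret h: ring_hom_ring R "R Quot I" "(+>\<^bsub>R\<^esub>) I" by (rule I.rcos_ring_hom_ring)
  have "abelian_group (quot_module R I)"
  proof (rule abelian_groupI)
    fix x
    assume "x \<in> carrier (quot_module R I)"
    then show "\<exists>y \<in> carrier (quot_module R I).
        y \<oplus>\<^bsub>quot_module R I\<^esub> x = \<zero>\<^bsub>quot_module R I\<^esub>"
      by (intro bexI[of _ "\<ominus>\<^bsub>R Quot I\<^esub> x"]) (simp_all add: quot_module_def Q.l_neg)
  qed (simp_all add: quot_module_def Q.a_ac)
  then show ?thesis
    by (rule moduleI[OF \<open>cring R\<close>])
      (simp_all add: quot_module_def Q.l_distr Q.r_distr Q.m_assoc)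
qed

text \<open>The submodule \<open>(f\<^sub>1, \<dots>, f\<^sub>r)M\<close> of \<open>M\<close>.\<close>

definition ideal_smult :: "('a, 'm, 'c) module_scheme \<Rightarrow> 'a list \<Rightarrow> 'm set" where
  "ideal_smult M fs =
    {finsum M (\<lambda>i. fs ! i \<odot>\<^bsub>M\<^esub> x i) {..<length fs} |x. x \<in> {..<length fs} \<rightarrow> carrier M}"

text \<open>
  The second condition says that multiplication by \<open>f\<^sub>i\<close> is injective on
  \<open>M/(f\<^sub>1, \<dots>, f\<^bsub>i-1\<^esub>)M\<close>, written out on representatives.
\<close>

definition regular_sequence ::
  "('a, 'b) ring_scheme \<Rightarrow> ('a, 'm, 'c) module_scheme \<Rightarrow> 'a list \<Rightarrow> bool" where
  "regular_sequence R M fs \<longleftrightarrow>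
    set fs \<subseteq> carrier R \<and>
    (\<forall>i < length fs. \<forall>x \<in> carrier M.
      fs ! i \<odot>\<^bsub>M\<^esub> x \<in> ideal_smult M (take i fs) \<longrightarrow> x \<in> ideal_smult M (take i fs)) \<and>
    ideal_smult M fs \<noteq> carrier M"

text \<open>
  The depth of \<open>M\<close> with respect to \<open>J\<close> is the maximal length of an \<open>M\<close>-regular sequence in \<open>J\<close>.
  It is a supremum in \<^typ>\<open>enat\<close>, so that no boundedness has to be presupposed.
\<close>

definition depth ::
  "('a, 'b) ring_scheme \<Rightarrow> 'a set \<Rightarrow> ('a, 'm, 'c) module_scheme \<Rightarrow> enat" where
  "depth R J M = (SUP fs \<in> {fs. set fs \<subseteq> J \<and> regular_sequence R M fs}. enat (length fs))"

section \<open>Stanley depth\<close>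

text \<open>
  A grading of a \<open>K[X]\<close>-module by exponent vectors is given by its family \<open>gr\<close> of homogeneous
  components.
\<close>

definition homogeneous_elem :: "(('v \<Rightarrow> int) \<Rightarrow> 'm set) \<Rightarrow> 'm \<Rightarrow> bool" where
  "homogeneous_elem gr w \<longleftrightarrow> (\<exists>a. w \<in> gr a)"

text \<open>
  The grading that \<open>K[X]/I\<close>, with \<open>I\<close> a monomial ideal, inherits from \<open>K[X]\<close>: the component of
  degree \<open>a\<close> is the image of the \<open>K\<close>-span of the monomial with exponent vector \<open>a\<close>.  It is zero if
  \<open>a\<close> has a negative entry or an entry outside \<open>X\<close>.
\<close>

definition quot_grading ::
  "'v set \<Rightarrow> ('v, 'k::field) mpoly set \<Rightarrow> ('v \<Rightarrow> int) \<Rightarrow> ('v, 'k) mpoly set set" where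
  "quot_grading X I a =
    (\<lambda>p. I +>\<^bsub>poly_ring X\<^esub> p) `
      {p \<in> carrier (poly_ring X). \<forall>t \<in> Poly_Mapping.keys p. \<forall>v. int (Poly_Mapping.lookup t v) = a v}"

definition stanley_space ::
  "(('v, 'k::field) mpoly, 'm, 'c) module_scheme \<Rightarrow> 'm \<times> 'v set \<Rightarrow> 'm set" where
  "stanley_space M = (\<lambda>(w, A). (\<lambda>f. f \<odot>\<^bsub>M\<^esub> w) ` carrier (poly_ring A))"

text \<open>
  The cyclic \<open>K[A]\<close>-module \<open>wK[A]\<close> is free on \<open>w\<close> iff \<open>f \<mapsto> fw\<close> is injective on \<open>K[A]\<close>.
  The last condition says that \<open>M\<close> is the internal direct sum of the spaces \<open>w\<^sub>iK[A\<^sub>i]\<close>.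
\<close>

definition stanley_decomposition ::
  "'v set \<Rightarrow> (('v, 'k::field) mpoly, 'm, 'c) module_scheme \<Rightarrow> (('v \<Rightarrow> int) \<Rightarrow> 'm set) \<Rightarrow>
    ('m \<times> 'v set) list \<Rightarrow> bool" where
  "stanley_decomposition X M gr ds \<longleftrightarrow>
    (\<forall>(w, A) \<in> set ds.
      w \<in> carrier M \<and> homogeneous_elem gr w \<and> A \<subseteq> X \<and>
      inj_on (\<lambda>f. f \<odot>\<^bsub>M\<^esub> w) (carrier (poly_ring A))) \<and>
    (\<forall>x \<in> carrier M. \<exists>!y. y \<in> (\<Pi>\<^sub>E i \<in> {..<length ds}. stanley_space M (ds ! i)) \<and>
      x = finsum M y {..<length ds})"

definition sdepth_decomposition :: "('m \<times> 'v set) list \<Rightarrow> enat" where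
  "sdepth_decomposition ds = (INF (w, A) \<in> set ds. enat (card A))"

definition sdepth ::
  "'v set \<Rightarrow> (('v, 'k::field) mpoly, 'm, 'c) module_scheme \<Rightarrow> (('v \<Rightarrow> int) \<Rightarrow> 'm set) \<Rightarrow> enat" where
  "sdepth X M gr = (SUP ds \<in> {ds. stanley_decomposition X M gr ds}. sdepth_decomposition ds)"

end

theory Submission
  imports Defs
begin

text \<open>
  Let \<open>D\<close> be an independent set of vertices of a graph \<open>G\<close> such that every other vertex is adjacent
  to a vertex of \<open>D\<close>, and let \<open>u\<close> be the product of the vertices of \<open>D\<close>.  Then \<open>u\<close> is not
  in \<open>I = I(G)\<close>, while \<open>xu\<close> is in \<open>I\<close> for each variable \<open>x\<close> outside \<open>D\<close>.  So the submodule
  generated by \<open>u\<close> in \<open>M = S/I\<close> is \<open>S/P\<close> up to a shift of degrees, where \<open>P\<close> is generated by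
  the variables outside \<open>D\<close>, and both
  depths of \<open>M\<close> are at most \<open>dim S/P = card D\<close>
  (\<open>depth_sdepth_le_independent_dominating_set\<close>).  In a path the vertices \<open>2, 5, 8, \<dots>\<close>,
  completed by the last vertex where necessary, form such a set, and
  the product of two of these sets is one in the strong product of the two paths.

  For the Stanley depth (\<open>sdepth_le\<close>) it suffices to look at a Stanley space \<open>wK[A]\<close> that
  contributes to \<open>u\<close>: a variable of \<open>A\<close> outside \<open>D\<close> would annihilate a nonzero element of
  this free \<open>K[A]\<close>-module.

  The bound for the depth (\<open>depth_le\<close>) is obtained without dimension theory, from three facts.
  Let \<open>f\<^sub>1, \<dots>, f\<^sub>r\<close> be regular on \<open>M\<close> with \<open>r > card D\<close>.

  \<^item> The powers \<open>f\<^sub>1\<^sup>k, \<dots>, f\<^sub>r\<^sup>k\<close> are weakly regular on \<open>M\<close> (\<open>weakly_regular_powers\<close>).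
  \<^item> Modulo \<open>P\<close> they are \<open>r\<close> polynomials in fewer than \<open>r\<close> variables, so
    they satisfy a nontrivial polynomial relation over \<open>K\<close> (\<open>polynomial_relation\<close>).
    Evaluated at the powers in \<open>S\<close>, this polynomial lies in \<open>P\<close> and annihilates \<open>u\<close> in \<open>M\<close>.
  \<^item> If a nontrivial polynomial over \<open>K\<close> in the elements of a weakly regular sequence
    annihilates an element of \<open>M\<close>, then this element lies in the submodule generated by the sequence
    (\<open>relation_imp_mem_adjoin_list\<close>).

  Hence \<open>u\<close> lies in \<open>I + (f\<^sub>1\<^sup>k, \<dots>, f\<^sub>r\<^sup>k)\<close> for every \<open>k\<close>.  The \<open>f\<^sub>i\<close> have no constant term,
  so for \<open>k > deg u\<close> this is impossible by degree.
\<close>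

section \<open>Weakly regular sequences\<close>

definition monomial_value :: "'a::comm_monoid_mult list \<Rightarrow> nat list \<Rightarrow> 'a" where
  "monomial_value fs \<alpha> = prod_list (map2 (^) fs \<alpha>)"

text \<open>
  The ring \<open>K[X]\<close> is a subset of the type of all polynomials.  Working in a subring \<open>S\<close> of a
  ring type makes ring normalisation available; a quotient module \<open>S/J\<close> never appears as such but
  is represented by the ideal \<open>J\<close>.
\<close>

locale subring_of_type =
  fixes S :: "'a::comm_ring_1 set"
  assumes zero_closed: "0 \<in> S" and one_closed: "1 \<in> S"
    and add_closed: "a \<in> S \<Longrightarrow> b \<in> S \<Longrightarrow> a + b \<in> S"
    and uminus_closed: "a \<in> S \<Longrightarrow> - a \<in> S"
    and mult_closed: "a \<in> S \<Longrightarrow> b \<in> S \<Longrightarrow> a * b \<in> S"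
begin

lemma diff_closed: "a \<in> S \<Longrightarrow> b \<in> S \<Longrightarrow> a - b \<in> S"
  using add_closed[of a "- b"] uminus_closed by simp

lemma power_closed: "a \<in> S \<Longrightarrow> a ^ k \<in> S"
  by (induction k) (auto simp: one_closed mult_closed)

lemma sum_closed: "(\<And>i. i \<in> A \<Longrightarrow> g i \<in> S) \<Longrightarrow> sum g A \<in> S"
  by (induction A rule: infinite_finite_induct) (auto simp: zero_closed add_closed)

lemma prod_list_closed: "set xs \<subseteq> S \<Longrightarrow> prod_list xs \<in> S"
  by (induction xs) (auto simp: one_closed mult_closed)

definition is_ideal :: "'a set \<Rightarrow> bool" where
  "is_ideal J \<longleftrightarrow> J \<subseteq> S \<and> 0 \<in> J \<and> (\<forall>a \<in> J. \<forall>b \<in> J. a + b \<in> J) \<and> (\<forall>a \<in> J. \<forall>s \<in> S. s * a \<in> J)"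

lemma is_idealD:
  assumes "is_ideal J"
  shows "J \<subseteq> S" "0 \<in> J" "a \<in> J \<Longrightarrow> b \<in> J \<Longrightarrow> a + b \<in> J" "a \<in> J \<Longrightarrow> s \<in> S \<Longrightarrow> s * a \<in> J"
    "a \<in> J \<Longrightarrow> - a \<in> J" "a \<in> J \<Longrightarrow> b \<in> J \<Longrightarrow> a - b \<in> J"
proof -
  have neg: "- b \<in> J" if "b \<in> J" for b
    using assms that uminus_closed[OF one_closed] by (fastforce simp: is_ideal_def)
  show "J \<subseteq> S" "0 \<in> J" "a \<in> J \<Longrightarrow> b \<in> J \<Longrightarrow> a + b \<in> J" "a \<in> J \<Longrightarrow> s \<in> S \<Longrightarrow> s * a \<in> J"
    "a \<in> J \<Longrightarrow> - a \<in> J"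
    using assms neg by (auto simp: is_ideal_def)
  show "a \<in> J \<Longrightarrow> b \<in> J \<Longrightarrow> a - b \<in> J"
    using assms neg[of b] by (auto simp: is_ideal_def)
qed

lemma is_ideal_sum:
  "is_ideal J \<Longrightarrow> (\<And>i. i \<in> A \<Longrightarrow> g i \<in> J) \<Longrightarrow> sum g A \<in> J"
  by (induction A rule: infinite_finite_induct) (auto intro: is_idealD)

text \<open>
  \<open>adjoin J f\<close> is the ideal \<open>J + fS\<close>: passing from \<open>J\<close> to it is passing from \<open>M = S/J\<close> to
  \<open>M/fM\<close>.
\<close>

definition adjoin :: "'a set \<Rightarrow> 'a \<Rightarrow> 'a set" where
  "adjoin J f = {a + f * s |a s. a \<in> J \<and> s \<in> S}"

lemma adjoinI: "a \<in> J \<Longrightarrow> s \<in> S \<Longrightarrow> a + f * s \<in> adjoin J f"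
  by (auto simp: adjoin_def)

lemma mem_adjoin_iff: "x \<in> adjoin J f \<longleftrightarrow> (\<exists>t \<in> S. x - f * t \<in> J)"
proof
  assume "\<exists>t \<in> S. x - f * t \<in> J"
  then obtain t where "t \<in> S" "x - f * t \<in> J" by blast
  then show "x \<in> adjoin J f" using adjoinI[of "x - f * t" J t f] by simp
next
  assume "x \<in> adjoin J f"
  then obtain a s where "x = a + f * s" "a \<in> J" "s \<in> S" by (auto simp: adjoin_def)
  then show "\<exists>t \<in> S. x - f * t \<in> J" by (intro bexI[of _ s]) simp_all
qed

lemma subset_adjoin: "J \<subseteq> adjoin J f"
  using adjoinI[OF _ zero_closed] by fastforce

lemma is_ideal_adjoin:
  assumes J: "is_ideal J" and f: "f \<in> S"
  shows "is_ideal (adjoin J f)"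
  unfolding is_ideal_def
proof (intro conjI ballI)
  note J' = is_idealD[OF J]
  show "adjoin J f \<subseteq> S"
    using J'(1) f by (auto simp: adjoin_def intro!: add_closed mult_closed)
  show "0 \<in> adjoin J f"
    using subset_adjoin J'(2) by blast
  fix x assume "x \<in> adjoin J f"
  then obtain a s where x: "x = a + f * s" "a \<in> J" "s \<in> S"
    by (auto simp: adjoin_def)
  show "x + y \<in> adjoin J f" if "y \<in> adjoin J f" for y
  proof -
    from that obtain b t where "y = b + f * t" "b \<in> J" "t \<in> S"
      by (auto simp: adjoin_def)
    then show ?thesis
      using adjoinI[of "a + b" J "s + t" f] x J'(3) add_closed by (simp add: algebra_simps)
  qed
  show "t * x \<in> adjoin J f" if "t \<in> S" for t
    using adjoinI[of "t * a" J "t * s" f] that x J'(4) mult_closed by (simp add: algebra_simps)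
qed

fun adjoin_list :: "'a set \<Rightarrow> 'a list \<Rightarrow> 'a set" where
  "adjoin_list J [] = J"
| "adjoin_list J (f # fs) = adjoin_list (adjoin J f) fs"

text \<open>
  A regular sequence on \<open>S/J\<close> without the condition that the last quotient is nonzero.
  Quotients are taken from the front of the list, so that inductions
  replace \<open>J\<close> by \<open>J + fS\<close>.
\<close>

fun weakly_regular :: "'a set \<Rightarrow> 'a list \<Rightarrow> bool" where
  "weakly_regular J [] \<longleftrightarrow> True"
| "weakly_regular J (f # fs) \<longleftrightarrow>
    (\<forall>x \<in> S. f * x \<in> J \<longrightarrow> x \<in> J) \<and> weakly_regular (adjoin J f) fs"

lemma weakly_regular_iff_nth:
  "weakly_regular J fs \<longleftrightarrow>
    (\<forall>i < length fs. \<forall>x \<in> S. fs ! i * x \<in> adjoin_list J (take i fs) \<longrightarrow>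
      x \<in> adjoin_list J (take i fs))"
proof (induction fs arbitrary: J)
  case (Cons f fs)
  show ?case
    by (simp add: Cons.IH All_less_Suc2)
qed simp

lemma adjoin_list_explicit:
  assumes "x \<in> S" "set fs \<subseteq> S"
  shows "x \<in> adjoin_list J fs \<longleftrightarrow>
    (\<exists>s \<in> {..<length fs} \<rightarrow> S. x - (\<Sum>i<length fs. fs ! i * s i) \<in> J)"
  using assms
proof (induction fs arbitrary: J)
  case Nil
  then show ?case by auto
next
  case (Cons f fs)
  have "x \<in> adjoin_list (adjoin J f) fs \<longleftrightarrow>
      (\<exists>s \<in> {..<length fs} \<rightarrow> S. x - (\<Sum>i<length fs. fs ! i * s i) \<in> adjoin J f)"
    using Cons by simp
  also have "\<dots> \<longleftrightarrow> (\<exists>s \<in> {..<length fs} \<rightarrow> S. \<exists>t \<in> S. x - (\<Sum>i<length fs. fs ! i * s i) - f * t \<in> J)"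
    by (simp only: mem_adjoin_iff)
  also have "\<dots> \<longleftrightarrow> (\<exists>s \<in> {..<Suc (length fs)} \<rightarrow> S. x - (\<Sum>i<Suc (length fs). (f # fs) ! i * s i) \<in> J)"
  proof safe
    fix s t assume "s \<in> {..<length fs} \<rightarrow> S" "t \<in> S" "x - (\<Sum>i<length fs. fs ! i * s i) - f * t \<in> J"
    then show "\<exists>s \<in> {..<Suc (length fs)} \<rightarrow> S. x - (\<Sum>i<Suc (length fs). (f # fs) ! i * s i) \<in> J"
      by (intro bexI[of _ "case_nat t s"])
        (auto simp: sum.lessThan_Suc_shift algebra_simps Pi_iff split: nat.split simp del: sum.lessThan_Suc)
  next
    fix s assume s: "s \<in> {..<Suc (length fs)} \<rightarrow> S"
      "x - (\<Sum>i<Suc (length fs). (f # fs) ! i * s i) \<in> J"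
    show "\<exists>s \<in> {..<length fs} \<rightarrow> S. \<exists>t \<in> S. x - (\<Sum>i<length fs. fs ! i * s i) - f * t \<in> J"
      using s by (intro bexI[of _ "s \<circ> Suc"] bexI[of _ "s 0"])
        (auto simp: sum.lessThan_Suc_shift algebra_simps Pi_iff simp del: sum.lessThan_Suc)
  qed
  finally show ?case by simp
qed

text \<open>
  The hypotheses on \<open>A\<close>, \<open>B\<close>, \<open>C\<close> express the exact sequence
  \<open>0 \<rightarrow> S/A \<rightarrow> S/B \<rightarrow> S/C \<rightarrow> 0\<close> whose first map is multiplication by \<open>f\<close>.  An element \<open>h\<close> that is
  regular on both ends is regular in the middle, and, because \<open>h\<close> is regular on \<open>S/C\<close>, the sequence
  stays exact modulo \<open>h\<close> (the snake lemma, written out on elements).  The same shape is therefore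
  available for the next element.
\<close>

lemma weakly_regular_extension:
  assumes "is_ideal A" "is_ideal B" "is_ideal C" "f \<in> S" "set hs \<subseteq> S"
    and "\<And>v. v \<in> S \<Longrightarrow> f * v \<in> B \<longleftrightarrow> v \<in> A"
    and "C = adjoin B f"
    and "weakly_regular A hs" "weakly_regular C hs"
  shows "weakly_regular B hs"
  using assms
proof (induction hs arbitrary: A B C)
  case (Cons h hs)
  note A = is_idealD[OF Cons.prems(1)] and B = is_idealD[OF Cons.prems(2)]
    and C = is_idealD[OF Cons.prems(3)]
  have h: "h \<in> S" "set hs \<subseteq> S" using Cons.prems by auto
  have AB: "f * v \<in> B \<longleftrightarrow> v \<in> A" if "v \<in> S" for v using Cons.prems(6) that .
  have BC: "B \<subseteq> C" using subset_adjoin Cons.prems(7) by blast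
  have regA: "x \<in> A" if "x \<in> S" "h * x \<in> A" for x using Cons.prems(8) that by simp
  have regC: "x \<in> C" if "x \<in> S" "h * x \<in> C" for x using Cons.prems(9) that by simp
  have C_cases: "\<exists>b \<in> B. \<exists>y \<in> S. x = b + f * y" if "x \<in> C" for x
    using that Cons.prems(7) by (auto simp: adjoin_def)
  have "x \<in> B" if x: "x \<in> S" "h * x \<in> B" for x
  proof -
    obtain b y where by_eq: "b \<in> B" "y \<in> S" "x = b + f * y"
      using C_cases regC x BC by blast
    have "f * (h * y) = h * x - h * b" using by_eq(3) by (simp add: algebra_simps)
    also have "\<dots> \<in> B" using B(4,6) x(2) by_eq(1) h by blast
    finally have "y \<in> A" using AB[of "h * y"] regA by_eq(2) h mult_closed by blast
    then show ?thesis using AB[of y] by_eq B(3) by blast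
  qed
  moreover have "weakly_regular (adjoin B h) hs"
  proof (rule Cons.IH)
    show "is_ideal (adjoin A h)" "is_ideal (adjoin B h)" "is_ideal (adjoin C h)"
      using Cons.prems h by (auto intro: is_ideal_adjoin)
    show "f * v \<in> adjoin B h \<longleftrightarrow> v \<in> adjoin A h" if v: "v \<in> S" for v
    proof
      assume "f * v \<in> adjoin B h"
      then obtain b s where bs: "b \<in> B" "s \<in> S" "f * v = b + h * s" by (auto simp: adjoin_def)
      have "h * s = - b + f * v" using bs(3) by simp
      also have "\<dots> \<in> C"
        using adjoinI[of "- b" B v f] B(5) bs v Cons.prems(7) by blast
      finally have "s \<in> C" using regC bs by blast
      then obtain b' y where y: "b' \<in> B" "y \<in> S" "s = b' + f * y" using C_cases by blast
      have "f * (v - h * y) = b + h * b'" using bs y by (simp add: algebra_simps)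
      also have "\<dots> \<in> B" using B(3,4) bs y h by blast
      finally have "v - h * y \<in> A"
        using AB[of "v - h * y"] v y h mult_closed diff_closed by blast
      then show "v \<in> adjoin A h" using adjoinI[of "v - h * y" A y h] y by simp
    next
      assume "v \<in> adjoin A h"
      then obtain a s where as: "a \<in> A" "s \<in> S" "v = a + h * s" by (auto simp: adjoin_def)
      then have "f * a \<in> B" using AB[of a] A(1) by blast
      then show "f * v \<in> adjoin B h"
        using adjoinI[of "f * a" B "f * s" h] as mult_closed Cons.prems(4)
        by (simp add: algebra_simps)
    qed
    show "adjoin C h = adjoin (adjoin B h) f"
      unfolding Cons.prems(7)
      by (auto simp: adjoin_def) (metis add.assoc add.commute)+
  qed (use Cons.prems h in auto)
  ultimately show ?case by simp
qed simp

text \<open>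
  This is the case \<open>0 \<rightarrow> M/gM \<rightarrow> M/fgM \<rightarrow> M/fM \<rightarrow> 0\<close> of the preceding lemma.
\<close>

lemma weakly_regular_mult:
  assumes J: "is_ideal J" and f: "f \<in> S" and g: "g \<in> S" and hs: "set hs \<subseteq> S"
    and rf: "weakly_regular J (f # hs)" and rg: "weakly_regular J (g # hs)"
  shows "weakly_regular J (f * g # hs)"
proof -
  note J' = is_idealD[OF J]
  have fg: "f * g \<in> S" using f g mult_closed by blast
  have "weakly_regular (adjoin J (f * g)) hs"
  proof (rule weakly_regular_extension)
    show "is_ideal (adjoin J g)" "is_ideal (adjoin J (f * g))" "is_ideal (adjoin J f)"
      using J f g fg by (auto intro: is_ideal_adjoin)
    show "f * v \<in> adjoin J (f * g) \<longleftrightarrow> v \<in> adjoin J g" if v: "v \<in> S" for v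
    proof
      assume "f * v \<in> adjoin J (f * g)"
      then obtain a s where as: "a \<in> J" "s \<in> S" "f * v = a + f * g * s" by (auto simp: adjoin_def)
      then have "f * (v - g * s) \<in> J" by (simp add: algebra_simps)
      then have "v - g * s \<in> J" using rf v g as mult_closed diff_closed by auto
      then show "v \<in> adjoin J g" using adjoinI[of "v - g * s" J s g] as by simp
    next
      assume "v \<in> adjoin J g"
      then obtain a s where as: "a \<in> J" "s \<in> S" "v = a + g * s" by (auto simp: adjoin_def)
      then show "f * v \<in> adjoin J (f * g)"
        using adjoinI[of "f * a" J s "f * g"] J'(4) f by (simp add: algebra_simps)
    qed
    show "adjoin J f = adjoin (adjoin J (f * g)) f"
    proof
      show "adjoin J f \<subseteq> adjoin (adjoin J (f * g)) f"
        using subset_adjoin[of J "f * g"] by (auto simp: adjoin_def[of _ f])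
      show "adjoin (adjoin J (f * g)) f \<subseteq> adjoin J f"
      proof
        fix x assume "x \<in> adjoin (adjoin J (f * g)) f"
        then obtain a s t where "x = a + f * g * s + f * t" "a \<in> J" "s \<in> S" "t \<in> S"
          by (auto simp: adjoin_def)
        then show "x \<in> adjoin J f"
          using adjoinI[of a J "g * s + t" f] g mult_closed add_closed by (simp add: algebra_simps)
      qed
    qed
  qed (use assms in auto)
  moreover have "x \<in> J" if "x \<in> S" "f * g * x \<in> J" for x
    using that rf rg g mult_closed by (simp add: mult.assoc)
  ultimately show ?thesis by simp
qed

text \<open>
  Powers of a single element at the front of the list come from the product lemma; the remaining
  elements are then handled over the enlarged ideal.
\<close>

lemma weakly_regular_powers:
  assumes "is_ideal J" "set fs \<subseteq> S" "weakly_regular J fs"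
  shows "weakly_regular J (map (\<lambda>f. f ^ Suc k) fs)"
  using assms
proof (induction fs arbitrary: J)
  case (Cons f fs)
  have f: "f \<in> S" "set fs \<subseteq> S" using Cons.prems by auto
  have "weakly_regular J (f ^ Suc l # fs)" for l
  proof (induction l)
    case 0
    show ?case using Cons.prems(3) by (simp only: power_Suc power_0 mult_1_right)
  next
    case (Suc l)
    show ?case
      unfolding power_Suc[of f "Suc l"]
      by (rule weakly_regular_mult[OF Cons.prems(1) f(1) power_closed[OF f(1)] f(2) Cons.prems(3) Suc])
  qed
  then have *: "weakly_regular J (f ^ Suc k # fs)" .
  moreover from * have "weakly_regular (adjoin J (f ^ Suc k)) fs"
    by (simp only: weakly_regular.simps)
  then have "weakly_regular (adjoin J (f ^ Suc k)) (map (\<lambda>f. f ^ Suc k) fs)"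
    by (intro Cons.IH is_ideal_adjoin power_closed f Cons.prems(1))
  ultimately show ?case
    unfolding weakly_regular.simps list.map by blast
qed simp

lemma monomial_value_closed: "set fs \<subseteq> S \<Longrightarrow> monomial_value fs \<alpha> \<in> S"
  unfolding monomial_value_def
  by (intro prod_list_closed) (auto dest!: set_zip_leftD intro: power_closed)

text \<open>
  Let \<open>l\<close> be the least exponent of the first element \<open>f\<close> in the relation.  Since \<open>f\<close> is a
  nonzerodivisor, \<open>f\<^sup>l\<close> cancels; modulo \<open>f\<close> only the terms of exponent exactly \<open>l\<close> survive,
  and they form a relation between the remaining elements, whose coefficients are again units.
  At the end of the list a single coefficient times \<open>w\<close> is left.
\<close>

lemma relation_imp_mem_adjoin_list:
  assumes "is_ideal J" "set fs \<subseteq> S" "weakly_regular J fs" "w \<in> S"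
    and "finite F" "\<And>\<alpha>. \<alpha> \<in> F \<Longrightarrow> length \<alpha> = length fs"
    and "\<And>\<alpha>. \<alpha> \<in> F \<Longrightarrow> c \<alpha> \<in> S" and "F \<noteq> {}" "\<And>\<alpha>. \<alpha> \<in> F \<Longrightarrow> \<exists>d \<in> S. d * c \<alpha> = 1"
    and "(\<Sum>\<alpha> \<in> F. c \<alpha> * monomial_value fs \<alpha>) * w \<in> J"
  shows "w \<in> adjoin_list J fs"
  using assms
proof (induction fs arbitrary: J F c)
  case Nil
  then have F: "F = {[]}" by auto
  obtain d where "d \<in> S" "d * c [] = 1" using Nil.prems(9)[of "[]"] F by auto
  moreover have "c [] * w \<in> J" using Nil.prems(10) by (simp add: F monomial_value_def)
  ultimately show ?case
    using is_idealD(4)[OF Nil.prems(1), of "c [] * w" d] by (simp add: mult.assoc[symmetric])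
next
  case (Cons f fs)
  note J = is_idealD[OF Cons.prems(1)]
  have f: "f \<in> S" "set fs \<subseteq> S" using Cons.prems by auto
  have mv: "monomial_value (f # fs) \<alpha> = f ^ hd \<alpha> * monomial_value fs (tl \<alpha>)" if "\<alpha> \<in> F" for \<alpha>
    using Cons.prems(6)[OF that] by (cases \<alpha>) (auto simp: monomial_value_def)
  define l where "l = Min (hd ` F)"
  have l_le: "l \<le> hd \<alpha>" if "\<alpha> \<in> F" for \<alpha>
    using that Cons.prems(5) by (simp add: l_def)
  have "l \<in> hd ` F" unfolding l_def using Cons.prems(5,8) by (intro Min_in) auto
  then obtain \<alpha>1 where a1: "\<alpha>1 \<in> F" "hd \<alpha>1 = l" by auto
  define F0 where "F0 = {\<alpha> \<in> F. hd \<alpha> = l}"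
  \<comment> \<open>The relation is \<open>f\<^sup>l (low + f high)\<close>, and \<open>low\<close> involves only the remaining elements.\<close>
  define low where "low = (\<Sum>\<alpha> \<in> F0. c \<alpha> * monomial_value fs (tl \<alpha>))"
  define high where "high = (\<Sum>\<alpha> \<in> F - F0. c \<alpha> * f ^ (hd \<alpha> - Suc l) * monomial_value fs (tl \<alpha>))"
  have F0: "F0 \<subseteq> F" "finite F0" using Cons.prems(5) by (auto simp: F0_def)
  have high: "high \<in> S" unfolding high_def
    using Cons.prems(7) f by (intro sum_closed mult_closed power_closed monomial_value_closed) auto
  have low: "low \<in> S" unfolding low_def
    using Cons.prems(7) f F0 by (intro sum_closed mult_closed monomial_value_closed) auto
  have "(\<Sum>\<alpha> \<in> F. c \<alpha> * monomial_value (f # fs) \<alpha>)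
      = (\<Sum>\<alpha> \<in> F0. c \<alpha> * monomial_value (f # fs) \<alpha>) + (\<Sum>\<alpha> \<in> F - F0. c \<alpha> * monomial_value (f # fs) \<alpha>)"
    using sum.subset_diff[OF F0(1) Cons.prems(5)] by (simp add: add.commute)
  also have "(\<Sum>\<alpha> \<in> F0. c \<alpha> * monomial_value (f # fs) \<alpha>) = f ^ l * low"
    unfolding low_def sum_distrib_left by (intro sum.cong) (auto simp: F0_def mv algebra_simps)
  also have "(\<Sum>\<alpha> \<in> F - F0. c \<alpha> * monomial_value (f # fs) \<alpha>) = f ^ l * (f * high)"
    unfolding high_def sum_distrib_left
  proof (intro sum.cong refl)
    fix \<alpha> assume a: "\<alpha> \<in> F - F0"
    then have "hd \<alpha> = l + Suc (hd \<alpha> - Suc l)" using l_le[of \<alpha>] by (auto simp: F0_def)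
    then have "f ^ hd \<alpha> = f ^ (l + Suc (hd \<alpha> - Suc l))" by (rule arg_cong)
    also have "\<dots> = f ^ l * f * f ^ (hd \<alpha> - Suc l)" by (simp add: power_add mult.assoc)
    finally have "f ^ hd \<alpha> = f ^ l * f * f ^ (hd \<alpha> - Suc l)" .
    then show "c \<alpha> * monomial_value (f # fs) \<alpha> =
        f ^ l * (f * (c \<alpha> * f ^ (hd \<alpha> - Suc l) * monomial_value fs (tl \<alpha>)))"
      using a by (simp add: mv algebra_simps)
  qed
  finally have "(\<Sum>\<alpha> \<in> F. c \<alpha> * monomial_value (f # fs) \<alpha>) * w = f ^ l * (low * w + f * (high * w))"
    by (simp only: distrib_left distrib_right mult.assoc)
  with Cons.prems(10) have rel: "f ^ l * (low * w + f * (high * w)) \<in> J"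
    by (simp only:)
  have cancel: "x \<in> J" if "x \<in> S" "f ^ k * x \<in> J" for x k
    using that
  proof (induction k)
    case (Suc k)
    have "f * (f ^ k * x) \<in> J" using Suc.prems(2) by (simp only: power_Suc mult.assoc)
    moreover have "f ^ k * x \<in> S" using Suc.prems(1) f mult_closed power_closed by blast
    ultimately have "f ^ k * x \<in> J" using Cons.prems(3) by simp
    then show ?case using Suc by blast
  qed simp
  have "low * w + f * (high * w) \<in> S"
    by (intro add_closed mult_closed low high f Cons.prems(4))
  from cancel[OF this rel] have "low * w + f * (high * w) \<in> J" .
  then have "low * w \<in> adjoin J f"
    using adjoinI[of "low * w + f * (high * w)" J "- (high * w)" f] high Cons.prems(4)
      mult_closed uminus_closed by simp
  have inj: "inj_on tl F0"
  proof (rule inj_onI)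
    fix a b assume "a \<in> F0" "b \<in> F0" "tl a = tl b"
    then show "a = b" using Cons.prems(6)[of a] Cons.prems(6)[of b]
      by (cases a; cases b) (auto simp: F0_def)
  qed
  have low_tl: "low = (\<Sum>\<alpha> \<in> tl ` F0. c (l # \<alpha>) * monomial_value fs \<alpha>)"
    unfolding low_def sum.reindex[OF inj] comp_def
  proof (intro sum.cong refl)
    fix \<alpha> assume "\<alpha> \<in> F0"
    then have "l # tl \<alpha> = \<alpha>" using Cons.prems(6)[of \<alpha>] by (cases \<alpha>) (auto simp: F0_def)
    then show "c \<alpha> * monomial_value fs (tl \<alpha>) = c (l # tl \<alpha>) * monomial_value fs (tl \<alpha>)" by simp
  qed
  have cl: "l # \<beta> \<in> F \<and> length \<beta> = length fs" if \<beta>: "\<beta> \<in> tl ` F0" for \<beta>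
  proof -
    obtain \<alpha> where "\<alpha> \<in> F0" "\<beta> = tl \<alpha>" using \<beta> by blast
    then show ?thesis using Cons.prems(6)[of \<alpha>] by (cases \<alpha>) (auto simp: F0_def)
  qed
  have "w \<in> adjoin_list (adjoin J f) fs"
  proof (rule Cons.IH)
    show "tl ` F0 \<noteq> {}" using a1 by (auto simp: F0_def)
    show "(\<Sum>\<alpha> \<in> tl ` F0. c (l # \<alpha>) * monomial_value fs \<alpha>) * w \<in> adjoin J f"
      using \<open>low * w \<in> adjoin J f\<close> low_tl by simp
  qed (use Cons.prems f F0 cl in \<open>auto intro: is_ideal_adjoin\<close>)
  then show ?case by simp
qed

end

section \<open>Monomial ideals and edge ideals\<close>

lemma poly_ring_simps:
  fixes p q :: "('v, 'k::field) mpoly"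
  shows "p \<oplus>\<^bsub>poly_ring X\<^esub> q = p + q" "p \<otimes>\<^bsub>poly_ring X\<^esub> q = p * q"
    "\<zero>\<^bsub>poly_ring X\<^esub> = (0 :: ('v, 'k) mpoly)" "\<one>\<^bsub>poly_ring X\<^esub> = (1 :: ('v, 'k) mpoly)"
    "p \<in> carrier (poly_ring X) \<longleftrightarrow> (\<forall>t \<in> Poly_Mapping.keys p. Poly_Mapping.keys t \<subseteq> X)"
  by (simp_all add: poly_ring_def)

lemma poly_ring_uminus_closed:
  "(p :: ('v, 'k::field) mpoly) \<in> carrier (poly_ring X) \<Longrightarrow> - p \<in> carrier (poly_ring X)"
  by (simp add: poly_ring_simps)

lemma poly_ring_a_inv:
  fixes p :: "('v, 'k::field) mpoly"
  assumes "p \<in> carrier (poly_ring X)"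
  shows "\<ominus>\<^bsub>poly_ring X\<^esub> p = - p"
proof -
  interpret R: cring "poly_ring X :: ('v, 'k) mpoly ring" by (rule poly_ring_cring)
  show ?thesis
    using assms poly_ring_uminus_closed[OF assms]
    by (intro R.minus_equality) (simp_all add: poly_ring_simps(1,3))
qed

lemma subring_poly_ring: "subring_of_type (carrier (poly_ring X :: ('v, 'k::field) mpoly ring))"
proof -
  interpret R: cring "poly_ring X :: ('v, 'k) mpoly ring" by (rule poly_ring_cring)
  show ?thesis
    using R.zero_closed R.one_closed R.a_closed R.m_closed poly_ring_uminus_closed
    by unfold_locales (simp_all only: poly_ring_simps(1-4))
qed

lemma is_ideal_of_ideal:
  assumes "ideal I (poly_ring X :: ('v, 'k::field) mpoly ring)"
  shows "subring_of_type.is_ideal (carrier (poly_ring X)) I"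
proof -
  interpret subring_of_type "carrier (poly_ring X :: ('v, 'k) mpoly ring)"
    by (rule subring_poly_ring)
  interpret I: ideal I "poly_ring X :: ('v, 'k) mpoly ring" by fact
  show ?thesis
    unfolding is_ideal_def
  proof (intro conjI ballI)
    show "I \<subseteq> carrier (poly_ring X)" by (rule I.a_subset)
    show "0 \<in> I" using additive_subgroup.zero_closed[OF I.additive_subgroup_axioms] by (simp only: poly_ring_simps(3))
    show "a + b \<in> I" if "a \<in> I" "b \<in> I" for a b
      using additive_subgroup.a_closed[OF I.additive_subgroup_axioms that] by (simp only: poly_ring_simps(1))
    show "s * a \<in> I" if "a \<in> I" "s \<in> carrier (poly_ring X)" for a s
      using I.I_l_closed[OF that] by (simp only: poly_ring_simps(2))
  qed
qed

text \<open>
  A set of exponent vectors that is closed under addition of arbitrary vectors spans an ideal.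
\<close>

lemma monomial_ideal:
  fixes Q :: "('v \<Rightarrow>\<^sub>0 nat) \<Rightarrow> bool"
  assumes Q: "\<And>s t. Q t \<Longrightarrow> Q (s + t)"
  shows "ideal {p \<in> carrier (poly_ring X :: ('v, 'k::field) mpoly ring). \<forall>t \<in> Poly_Mapping.keys p. Q t}
    (poly_ring X)" (is "ideal ?I ?R")
proof -
  interpret R: cring ?R by (rule poly_ring_cring)
  interpret subring_of_type "carrier ?R" by (rule subring_poly_ring)
  have mult: "p * q \<in> ?I" if "p \<in> carrier ?R" "q \<in> ?I" for p q
  proof -
    have "Q t" if "t \<in> Poly_Mapping.keys (p * q)" for t
      using that keys_mult[of p q] \<open>q \<in> ?I\<close> Q by blast
    then show ?thesis using that mult_closed by blast
  qed
  have add: "p + q \<in> ?I" if "p \<in> ?I" "q \<in> ?I" for p q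
    using that Poly_Mapping.keys_add[of p q] add_closed by blast
  show ?thesis
  proof (rule idealI[OF R.ring_axioms])
    show "subgroup ?I (add_monoid ?R)"
    proof (rule R.add.subgroupI)
      show "?I \<noteq> {}" using zero_closed by fastforce
      show "\<ominus>\<^bsub>?R\<^esub> p \<in> ?I" if "p \<in> ?I" for p
        using that poly_ring_a_inv[of p X] uminus_closed by auto
      show "p \<oplus>\<^bsub>?R\<^esub> q \<in> ?I" if "p \<in> ?I" "q \<in> ?I" for p q
        unfolding poly_ring_simps(1) using add[OF that] .
    qed auto
    show "q \<otimes>\<^bsub>?R\<^esub> p \<in> ?I" "p \<otimes>\<^bsub>?R\<^esub> q \<in> ?I" if "p \<in> ?I" "q \<in> carrier ?R" for p q
      unfolding poly_ring_simps(2) mult.commute[of p q] by (rule mult[OF that(2,1)])+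
  qed
qed

lemma sum_single_lookup: "(\<Sum>t \<in> Poly_Mapping.keys p. Poly_Mapping.single t (Poly_Mapping.lookup p t)) = p"
proof (rule poly_mapping_eqI)
  fix s
  have "(\<Sum>t \<in> Poly_Mapping.keys p. Poly_Mapping.lookup (Poly_Mapping.single t (Poly_Mapping.lookup p t)) s)
      = (\<Sum>t \<in> Poly_Mapping.keys p. if t = s then Poly_Mapping.lookup p t else 0)"
    by (intro sum.cong) (auto simp: lookup_single when_def)
  also have "\<dots> = Poly_Mapping.lookup p s"
    by (simp add: in_keys_iff)
  finally show "Poly_Mapping.lookup (\<Sum>t \<in> Poly_Mapping.keys p. Poly_Mapping.single t (Poly_Mapping.lookup p t)) s
      = Poly_Mapping.lookup p s"
    by (simp add: lookup_sum)
qed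

lemma keys_add_nat:
  fixes s t :: "'v \<Rightarrow>\<^sub>0 nat"
  shows "Poly_Mapping.keys (s + t) = Poly_Mapping.keys s \<union> Poly_Mapping.keys t"
  by (auto simp: in_keys_iff lookup_add)

text \<open>
  The edge ideal is a monomial ideal, so membership can be tested term by term: every term has to be
  divisible by an edge.  Loops are excluded, so an edge \<open>uv\<close> divides a monomial as soon as both
  \<open>u\<close> and \<open>v\<close> occur in it.
\<close>

lemma mem_edge_ideal_iff:
  fixes p :: "('v, 'k::field) mpoly"
  assumes "pair_graph G"
  shows "p \<in> edge_ideal G \<longleftrightarrow> p \<in> carrier (poly_ring (pverts G)) \<and>
    (\<forall>t \<in> Poly_Mapping.keys p. \<exists>(u, v) \<in> parcs G. u \<in> Poly_Mapping.keys t \<and> v \<in> Poly_Mapping.keys t)"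
proof -
  interpret G: pair_graph G by fact
  let ?R = "poly_ring (pverts G) :: ('v, 'k) mpoly ring"
  let ?gens = "{pvar u * pvar v |u v. (u, v) \<in> parcs G} :: ('v, 'k) mpoly set"
  define Q where "Q t \<longleftrightarrow> (\<exists>(u, v) \<in> parcs G. u \<in> Poly_Mapping.keys t \<and> v \<in> Poly_Mapping.keys t)"
    for t :: "'v \<Rightarrow>\<^sub>0 nat"
  let ?J = "{p \<in> carrier ?R. \<forall>t \<in> Poly_Mapping.keys p. Q t}"
  interpret R: cring ?R by (rule poly_ring_cring)
  interpret subring_of_type "carrier ?R" by (rule subring_poly_ring)
  have gen: "pvar u * pvar v = (Poly_Mapping.single (Poly_Mapping.single u 1 + Poly_Mapping.single v 1) 1 :: ('v, 'k) mpoly)"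
    for u v by (simp add: pvar_def mult_single)
  have J: "ideal ?J ?R"
    by (rule monomial_ideal) (auto simp: Q_def keys_add_nat)
  have "?gens \<subseteq> ?J"
  proof safe
    fix u v assume uv: "(u, v) \<in> parcs G"
    then have "u \<in> pverts G" "v \<in> pverts G"
      using G.arc_fst_in_verts[of "(u, v)"] G.arc_snd_in_verts[of "(u, v)"] by auto
    then show "(pvar u * pvar v :: ('v, 'k) mpoly) \<in> carrier ?R"
      by (simp add: gen poly_ring_simps keys_add_nat)
    show "Q t" if "t \<in> Poly_Mapping.keys (pvar u * pvar v :: ('v, 'k) mpoly)" for t
      using that uv by (auto simp: gen Q_def keys_add_nat)
  qed
  then have "edge_ideal G \<subseteq> ?J"
    unfolding edge_ideal_def using R.genideal_minimal[OF J] by blast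
  moreover have "p \<in> edge_ideal G" if p: "p \<in> ?J" for p
  proof -
    have I: "is_ideal (edge_ideal G)"
      by (intro is_ideal_of_ideal edge_ideal_ideal assms)
    have "Poly_Mapping.single t (Poly_Mapping.lookup p t) \<in> edge_ideal G" if t: "t \<in> Poly_Mapping.keys p" for t
    proof -
      from p t obtain u v where uv: "(u, v) \<in> parcs G" "u \<in> Poly_Mapping.keys t" "v \<in> Poly_Mapping.keys t"
        by (auto simp: Q_def)
      have "u \<noteq> v" using G.no_loops[of "(u, v)"] uv by auto
      define e where "e = Poly_Mapping.single u (1::nat) + Poly_Mapping.single v 1"
      have e_le: "Poly_Mapping.lookup e x \<le> Poly_Mapping.lookup t x" for x
        using uv(2,3) \<open>u \<noteq> v\<close> by (auto simp: e_def lookup_add lookup_single when_def in_keys_iff)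
      have "t = (t - e) + e"
        using e_le by (intro poly_mapping_eqI) (simp add: lookup_add lookup_minus)
      then have "Poly_Mapping.single t (Poly_Mapping.lookup p t)
          = Poly_Mapping.single (t - e) (Poly_Mapping.lookup p t) * (pvar u * pvar v)"
        unfolding gen e_def[symmetric] mult_single by simp
      moreover have "(pvar u * pvar v :: ('v, 'k) mpoly) \<in> edge_ideal G"
        unfolding edge_ideal_def using R.genideal_self[of ?gens] \<open>?gens \<subseteq> ?J\<close> uv(1) by blast
      moreover have "Poly_Mapping.single (t - e) (Poly_Mapping.lookup p t) \<in> carrier ?R"
      proof -
        have "Poly_Mapping.keys (t - e) \<subseteq> Poly_Mapping.keys t"
          by (auto simp: in_keys_iff lookup_minus)
        then show ?thesis using p t by (auto simp: poly_ring_simps)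
      qed
      ultimately show ?thesis using is_idealD(4)[OF I] by simp
    qed
    then have "(\<Sum>t \<in> Poly_Mapping.keys p. Poly_Mapping.single t (Poly_Mapping.lookup p t)) \<in> edge_ideal G"
      by (rule is_ideal_sum[OF I])
    then show ?thesis by (simp add: sum_single_lookup)
  qed
  ultimately show ?thesis by (auto simp: Q_def)
qed

lemma max_ideal_zero_notin_keys:
  assumes "(p :: ('v, 'k::field) mpoly) \<in> max_ideal X"
  shows "p \<in> carrier (poly_ring X)" "0 \<notin> Poly_Mapping.keys p"
proof -
  let ?R = "poly_ring X :: ('v, 'k) mpoly ring"
  let ?J = "{p \<in> carrier ?R. \<forall>t \<in> Poly_Mapping.keys p. t \<noteq> 0}"
  interpret R: cring ?R by (rule poly_ring_cring)
  have "ideal ?J ?R"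
    by (rule monomial_ideal) (metis keys_add_nat keys_eq_empty sup_eq_bot_iff)
  moreover have "pvar ` X \<subseteq> ?J"
  proof safe
    fix x assume "x \<in> X"
    then show "pvar x \<in> carrier ?R"
      by (simp add: poly_ring_simps pvar_def)
    show False if "0 \<in> Poly_Mapping.keys (pvar x :: ('v, 'k) mpoly)"
    proof -
      have "(0 :: 'v \<Rightarrow>\<^sub>0 nat) = Poly_Mapping.single x 1" using that by (simp add: pvar_def)
      then have "Poly_Mapping.lookup (0 :: 'v \<Rightarrow>\<^sub>0 nat) x = Poly_Mapping.lookup (Poly_Mapping.single x (1::nat)) x"
        by (rule arg_cong)
      then show False by simp
    qed
  qed
  ultimately have "max_ideal X \<subseteq> ?J"
    unfolding max_ideal_def by (rule R.genideal_minimal)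
  then show "p \<in> carrier ?R" "0 \<notin> Poly_Mapping.keys p" using assms by auto
qed

definition tdeg :: "'v set \<Rightarrow> ('v \<Rightarrow>\<^sub>0 nat) \<Rightarrow> nat" where
  "tdeg X t = (\<Sum>v \<in> X. Poly_Mapping.lookup t v)"

lemma tdeg_add: "tdeg X (s + t) = tdeg X s + tdeg X t"
  by (simp add: tdeg_def lookup_add sum.distrib)

text \<open>
  Elements of the maximal ideal have no constant term, so each factor contributes at least one to
  the degree.
\<close>

lemma tdeg_power:
  fixes f :: "('v, 'k::field) mpoly"
  assumes "finite X" "f \<in> max_ideal X" "t \<in> Poly_Mapping.keys (f ^ k)"
  shows "k \<le> tdeg X t"
  using assms(3)
proof (induction k arbitrary: t)
  case (Suc k)
  then obtain a b where ab: "t = a + b" "a \<in> Poly_Mapping.keys f" "b \<in> Poly_Mapping.keys (f ^ k)"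
    using keys_mult[of f "f ^ k"] by auto
  have "Poly_Mapping.keys a \<subseteq> X" "a \<noteq> 0"
    using max_ideal_zero_notin_keys[OF assms(2)] ab(2) by (auto simp: poly_ring_simps)
  then obtain v where v: "v \<in> X" "v \<in> Poly_Mapping.keys a"
    using keys_eq_empty[of a] by blast
  then have "1 \<le> Poly_Mapping.lookup a v" by (simp add: in_keys_iff Suc_le_eq)
  also have "\<dots> \<le> tdeg X a"
    unfolding tdeg_def using assms(1) v(1) by (intro member_le_sum) auto
  finally have "1 \<le> tdeg X a" .
  then show ?case using Suc.IH[OF ab(3)] by (simp add: ab(1) tdeg_add)
qed simp

section \<open>A relation between more polynomials than variables\<close>

text \<open>
  Gaussian elimination, with \<open>A\<close> indexing the unknowns and \<open>T\<close> the equations.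
\<close>

lemma homogeneous_system_nontrivial_solution:
  fixes v :: "'a \<Rightarrow> 't \<Rightarrow> 'k::field"
  assumes "finite T" "finite A" "card T < card A"
  shows "\<exists>c. (\<exists>a \<in> A. c a \<noteq> 0) \<and> (\<forall>t \<in> T. (\<Sum>a \<in> A. c a * v a t) = 0)"
  using assms
proof (induction T arbitrary: A v rule: finite_induct)
  case empty
  then obtain a where "a \<in> A" by fastforce
  then show ?case by (intro exI[of _ "\<lambda>_. 1"]) auto
next
  case (insert t T)
  show ?case
  proof (cases "\<forall>a \<in> A. v a t = 0")
    case True
    have "card T < card A" using insert by simp
    from insert.IH[OF insert.prems(1) this, of v] obtain c
      where "\<exists>a \<in> A. c a \<noteq> 0" "\<forall>s \<in> T. (\<Sum>a \<in> A. c a * v a s) = 0" by blast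
    moreover have "(\<Sum>a \<in> A. c a * v a t) = 0" using True by simp
    ultimately show ?thesis by blast
  next
    case False
    then obtain b where b: "b \<in> A" "v b t \<noteq> 0" by auto
    \<comment> \<open>The equation \<open>t\<close> is solved for the unknown \<open>b\<close>, and \<open>b\<close> is eliminated from the others.\<close>
    define v' where "v' a s = v a s - v a t / v b t * v b s" for a s
    have "finite (A - {b})" "card T < card (A - {b})"
      using insert b by auto
    from insert.IH[OF this, of v'] obtain c
      where c: "\<exists>a \<in> A - {b}. c a \<noteq> 0" "\<forall>s \<in> T. (\<Sum>a \<in> A - {b}. c a * v' a s) = 0"
      by auto
    define e where "e = c(b := - (\<Sum>a \<in> A - {b}. c a * (v a t / v b t)))"
    have sum_e: "(\<Sum>a \<in> A. e a * v a s) = (\<Sum>a \<in> A - {b}. c a * v' a s)" for s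
    proof -
      have "(\<Sum>a \<in> A. e a * v a s) = e b * v b s + (\<Sum>a \<in> A - {b}. e a * v a s)"
        using insert.prems b by (simp add: sum.remove)
      also have "(\<Sum>a \<in> A - {b}. e a * v a s) = (\<Sum>a \<in> A - {b}. c a * v a s)"
        by (intro sum.cong) (auto simp: e_def)
      also have "e b * v b s = - (\<Sum>a \<in> A - {b}. c a * (v a t / v b t * v b s))"
        by (simp add: e_def sum_distrib_right mult.assoc)
      finally show ?thesis
        by (simp add: v'_def right_diff_distrib sum_subtractf)
    qed
    show ?thesis
    proof (intro exI[of _ e] conjI ballI)
      show "\<exists>a \<in> A. e a \<noteq> 0" using c(1) by (auto simp: e_def)
      have "v' a t = 0" for a using b(2) by (simp add: v'_def)
      then show "(\<Sum>a \<in> A. e a * v a s) = 0" if "s \<in> insert t T" for s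
        using that c(2) by (cases "s = t") (simp_all add: sum_e)
    qed
  qed
qed

lemma lookup_power_le:
  fixes f :: "('v, 'k::field) mpoly"
  assumes "\<And>s. s \<in> Poly_Mapping.keys f \<Longrightarrow> Poly_Mapping.lookup s v \<le> B"
    and "t \<in> Poly_Mapping.keys (f ^ k)"
  shows "Poly_Mapping.lookup t v \<le> k * B"
  using assms(2)
proof (induction k arbitrary: t)
  case (Suc k)
  then obtain a b where ab: "t = a + b" "a \<in> Poly_Mapping.keys f" "b \<in> Poly_Mapping.keys (f ^ k)"
    using keys_mult[of f "f ^ k"] by auto
  then show ?case using Suc.IH[OF ab(3)] assms(1)[OF ab(2)] by (simp add: lookup_add)
qed simp

lemma lookup_monomial_value_le:
  fixes fs :: "('v, 'k::field) mpoly list"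
  assumes "\<And>f s. f \<in> set fs \<Longrightarrow> s \<in> Poly_Mapping.keys f \<Longrightarrow> Poly_Mapping.lookup s v \<le> B"
    and "length \<alpha> = length fs" "set \<alpha> \<subseteq> {..<N}"
    and "t \<in> Poly_Mapping.keys (monomial_value fs \<alpha>)"
  shows "Poly_Mapping.lookup t v \<le> length fs * (N * B)"
  using assms
proof (induction fs arbitrary: \<alpha> t)
  case (Cons f fs)
  then obtain k \<beta> where \<alpha>: "\<alpha> = k # \<beta>" by (cases \<alpha>) auto
  have "monomial_value (f # fs) \<alpha> = f ^ k * monomial_value fs \<beta>"
    by (simp add: monomial_value_def \<alpha>)
  then obtain a b where ab: "t = a + b" "a \<in> Poly_Mapping.keys (f ^ k)"
      "b \<in> Poly_Mapping.keys (monomial_value fs \<beta>)"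
    using Cons.prems(4) keys_mult[of "f ^ k" "monomial_value fs \<beta>"] by auto
  have "Poly_Mapping.lookup a v \<le> k * B"
    using ab(2) Cons.prems(1) by (intro lookup_power_le) auto
  also have "\<dots> \<le> N * B" using Cons.prems(3) by (intro mult_right_mono) (auto simp: \<alpha>)
  finally have "Poly_Mapping.lookup a v \<le> N * B" .
  moreover have "Poly_Mapping.lookup b v \<le> length fs * (N * B)"
    using Cons.prems \<alpha> ab(3) by (intro Cons.IH) auto
  ultimately show ?case by (simp add: ab(1) lookup_add)
qed (simp add: monomial_value_def)

lemma exponents_bounded:
  fixes fs :: "('v, 'k::field) mpoly list"
  obtains B where "\<And>f s v. f \<in> set fs \<Longrightarrow> s \<in> Poly_Mapping.keys f \<Longrightarrow> Poly_Mapping.lookup s v \<le> B"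
proof -
  define E where "E = (\<Union>f \<in> set fs. \<Union>s \<in> Poly_Mapping.keys f. Poly_Mapping.lookup s ` Poly_Mapping.keys s)"
  have fin: "finite E" by (simp add: E_def)
  show thesis
  proof (rule that[of "Max (insert 0 E)"])
    fix f s v assume fs: "f \<in> set fs" "s \<in> Poly_Mapping.keys f"
    show "Poly_Mapping.lookup s v \<le> Max (insert 0 E)"
    proof (cases "v \<in> Poly_Mapping.keys s")
      case True
      then have "Poly_Mapping.lookup s v \<in> insert 0 E" using fs by (auto simp: E_def)
      then show ?thesis using fin by (intro Max_ge) auto
    qed (simp add: in_keys_iff)
  qed
qed

lemma card_bounded_exponents:
  fixes D :: "'v set" and B :: nat
  assumes "finite D"
  defines "T \<equiv> {t . Poly_Mapping.keys t \<subseteq> D \<and> (\<forall>v. Poly_Mapping.lookup t v \<le> B)}"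
  shows "finite T" "card T \<le> (B + 1) ^ card D"
proof -
  define r where "r t = restrict (Poly_Mapping.lookup t) D" for t :: "'v \<Rightarrow>\<^sub>0 nat"
  have fin: "finite (D \<rightarrow>\<^sub>E {..B})" using assms(1) by (intro finite_PiE) auto
  have sub: "r ` T \<subseteq> D \<rightarrow>\<^sub>E {..B}" by (auto simp: r_def T_def)
  have inj: "inj_on r T"
  proof (rule inj_onI)
    fix s t assume st: "s \<in> T" "t \<in> T" "r s = r t"
    show "s = t"
    proof (rule poly_mapping_eqI)
      fix v
      show "Poly_Mapping.lookup s v = Poly_Mapping.lookup t v"
      proof (cases "v \<in> D")
        case True
        then show ?thesis using fun_cong[OF st(3), of v] by (simp add: r_def)
      next
        case False
        then have "v \<notin> Poly_Mapping.keys s" "v \<notin> Poly_Mapping.keys t" using st by (auto simp: T_def)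
        then show ?thesis by (simp add: in_keys_iff)
      qed
    qed
  qed
  show "finite T" using inj_on_finite[OF inj sub fin] .
  show "card T \<le> (B + 1) ^ card D"
    using card_inj_on_le[OF inj sub fin] assms(1) by (simp add: card_PiE)
qed

text \<open>
  Algebraic dependence by counting.  The products \<open>f\<^sup>\<alpha>\<close> with all exponents below \<open>N\<close> are
  \<open>N\<^sup>r\<close> in number, where \<open>r\<close> is the number of polynomials.  Their terms in the variables of \<open>D\<close>
  alone have exponents \<open>O(N)\<close>, so there are only \<open>O(N\<^sup>d)\<close> of these terms, with \<open>d = card D < r\<close>.
  For large \<open>N\<close> some nontrivial combination of the products has no term in the
  variables of \<open>D\<close> alone.
\<close>

lemma polynomial_relation:
  fixes fs :: "('v, 'k::field) mpoly list"
  assumes "finite D" "card D < length fs"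
  obtains F and c :: "nat list \<Rightarrow> 'k" where "finite F" "F \<noteq> {}"
    "\<And>\<alpha>. \<alpha> \<in> F \<Longrightarrow> length \<alpha> = length fs \<and> c \<alpha> \<noteq> 0"
    "\<And>t. t \<in> Poly_Mapping.keys (\<Sum>\<alpha> \<in> F. Poly_Mapping.single 0 (c \<alpha>) * monomial_value fs \<alpha>) \<Longrightarrow> \<not> Poly_Mapping.keys t \<subseteq> D"
proof -
  obtain B where B: "\<And>f s v. f \<in> set fs \<Longrightarrow> s \<in> Poly_Mapping.keys f \<Longrightarrow> Poly_Mapping.lookup s v \<le> B"
    using exponents_bounded by blast
  define d where "d = card D"
  define r where "r = length fs"
  \<comment> \<open>With this \<open>N\<close> the count \<open>(r N B + 1)\<^sup>d \<le> N\<^sup>d (r B + 1)\<^sup>d < N\<^bsup>d + 1\<^esup>\<close> leaves a solution.\<close>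
  define N where "N = (r * B + 1) ^ d + 1"
  define T where "T = {t :: 'v \<Rightarrow>\<^sub>0 nat. Poly_Mapping.keys t \<subseteq> D \<and> (\<forall>v. Poly_Mapping.lookup t v \<le> r * (N * B))}"
  define A where "A = {\<alpha> :: nat list. set \<alpha> \<subseteq> {..<N} \<and> length \<alpha> = r}"
  have A: "finite A" "card A = N ^ r"
    using finite_lists_length_eq[of "{..<N}" r] card_lists_length_eq[of "{..<N}" r] by (simp_all add: A_def)
  have T: "finite T" "card T \<le> (r * (N * B) + 1) ^ d"
    unfolding T_def d_def by (rule card_bounded_exponents[OF assms(1)])+
  note T(2)
  also have "(r * (N * B) + 1) ^ d \<le> (N * (r * B + 1)) ^ d"
    by (intro power_mono) (simp_all add: N_def algebra_simps)
  also have "\<dots> = N ^ d * (r * B + 1) ^ d" by (rule power_mult_distrib)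
  also have "\<dots> < N ^ d * N" by (simp add: N_def)
  also have "\<dots> = N ^ Suc d" by simp
  also have "\<dots> \<le> N ^ r" using assms(2) by (intro power_increasing) (auto simp: N_def d_def r_def)
  finally have "card T < card A" by (simp add: A(2))
  from homogeneous_system_nontrivial_solution[OF T(1) A(1) this, of "\<lambda>\<alpha>. Poly_Mapping.lookup (monomial_value fs \<alpha>)"]
  obtain c where c: "\<exists>\<alpha> \<in> A. c \<alpha> \<noteq> 0"
      "\<forall>t \<in> T. (\<Sum>\<alpha> \<in> A. c \<alpha> * Poly_Mapping.lookup (monomial_value fs \<alpha>) t) = 0"
    by blast
  define F where "F = {\<alpha> \<in> A. c \<alpha> \<noteq> 0}"
  define P where "P = (\<Sum>\<alpha> \<in> F. Poly_Mapping.single 0 (c \<alpha>) * monomial_value fs \<alpha>)"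
  have lookup_P: "Poly_Mapping.lookup P t = (\<Sum>\<alpha> \<in> A. c \<alpha> * Poly_Mapping.lookup (monomial_value fs \<alpha>) t)" for t
  proof -
    have "Poly_Mapping.lookup P t = (\<Sum>\<alpha> \<in> F. c \<alpha> * Poly_Mapping.lookup (monomial_value fs \<alpha>) t)"
      unfolding P_def lookup_sum mult_map_scale_conv_mult[symmetric]
      by (intro sum.cong refl) (simp add: Poly_Mapping.map.rep_eq when_def)
    also have "\<dots> = (\<Sum>\<alpha> \<in> A. c \<alpha> * Poly_Mapping.lookup (monomial_value fs \<alpha>) t)"
      using A(1) by (intro sum.mono_neutral_left) (auto simp: F_def)
    finally show ?thesis .
  qed
  show thesis
  proof (rule that[of F c])
    show "finite F" "F \<noteq> {}" using A(1) c(1) by (auto simp: F_def)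
    show "length \<alpha> = length fs \<and> c \<alpha> \<noteq> 0" if "\<alpha> \<in> F" for \<alpha>
      using that by (auto simp: F_def A_def r_def)
    fix t assume t: "t \<in> Poly_Mapping.keys (\<Sum>\<alpha> \<in> F. Poly_Mapping.single 0 (c \<alpha>) * monomial_value fs \<alpha>)"
    then have nz: "Poly_Mapping.lookup P t \<noteq> 0" by (simp add: P_def in_keys_iff)
    then obtain \<alpha> where "\<alpha> \<in> A" "c \<alpha> * Poly_Mapping.lookup (monomial_value fs \<alpha>) t \<noteq> 0"
      unfolding lookup_P by (rule sum.not_neutral_contains_not_neutral)
    then have \<alpha>: "\<alpha> \<in> A" "Poly_Mapping.lookup (monomial_value fs \<alpha>) t \<noteq> 0"
      by simp_all
    have "Poly_Mapping.lookup t v \<le> r * (N * B)" for v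
      unfolding r_def
    proof (rule lookup_monomial_value_le)
      show "Poly_Mapping.lookup s v \<le> B" if "f \<in> set fs" "s \<in> Poly_Mapping.keys f" for f s
        using B that .
      show "length \<alpha> = length fs" "set \<alpha> \<subseteq> {..<N}" using \<alpha>(1) by (auto simp: A_def r_def)
      show "t \<in> Poly_Mapping.keys (monomial_value fs \<alpha>)" using \<alpha>(2) by (simp add: in_keys_iff)
    qed
    moreover have "t \<notin> T" using nz c(2) unfolding lookup_P by blast
    ultimately show "\<not> Poly_Mapping.keys t \<subseteq> D" by (auto simp: T_def)
  qed
qed

section \<open>Quotients of the polynomial ring\<close>

locale poly_quotient =
  fixes X :: "'v set" and I :: "('v, 'k::field) mpoly set"
  assumes ideal_I: "ideal I (poly_ring X)"
begin

sublocale subring_of_type "carrier (poly_ring X :: ('v, 'k) mpoly ring)"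
  by (rule subring_poly_ring)

abbreviation S :: "('v, 'k) mpoly set" where "S \<equiv> carrier (poly_ring X)"

abbreviation M :: "(('v, 'k) mpoly, ('v, 'k) mpoly set) module" where
  "M \<equiv> quot_module (poly_ring X) I"

definition cls :: "('v, 'k) mpoly \<Rightarrow> ('v, 'k) mpoly set" where
  "cls p = I +>\<^bsub>poly_ring X\<^esub> p"

lemma is_ideal_I: "is_ideal I"
  by (rule is_ideal_of_ideal[OF ideal_I])

lemma cls_hom: "ring_hom_ring (poly_ring X) (poly_ring X Quot I) cls"
  using ideal.rcos_ring_hom_ring[OF ideal_I] by (simp only: cls_def[abs_def])

lemma carrier_M: "carrier M = cls ` S"
  by (auto simp: quot_module_def FactRing_def A_RCOSETS_def RCOSETS_def cls_def a_r_coset_def)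

lemma cls_eq_iff:
  assumes "p \<in> S" "q \<in> S"
  shows "cls p = cls q \<longleftrightarrow> p - q \<in> I"
proof -
  interpret R: cring "poly_ring X :: ('v, 'k) mpoly ring" by (rule poly_ring_cring)
  show ?thesis
    using R.quotient_eq_iff_same_a_r_cos[OF ideal_I assms] assms(2)
    by (simp add: cls_def a_minus_def poly_ring_simps(1) poly_ring_a_inv del: poly_ring_simps(5))
qed

lemma smult_cls:
  assumes "f \<in> S" "p \<in> S"
  shows "f \<odot>\<^bsub>M\<^esub> cls p = cls (f * p)"
proof -
  interpret h: ring_hom_ring "poly_ring X" "poly_ring X Quot I" cls by (rule cls_hom)
  show ?thesis
    using h.hom_mult[OF assms] by (simp add: quot_module_def poly_ring_simps(2) cls_def)
qed

lemma finsum_cls: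
  assumes "finite A" "\<And>i. i \<in> A \<Longrightarrow> p i \<in> S"
  shows "finsum M (\<lambda>i. cls (p i)) A = cls (sum p A)"
proof -
  interpret h: ring_hom_ring "poly_ring X" "poly_ring X Quot I" cls by (rule cls_hom)
  interpret Mm: Module.module "poly_ring X" M
    by (rule quot_module_module[OF poly_ring_cring ideal_I])
  show ?thesis
    using assms
  proof (induction A rule: finite_induct)
    case empty
    have "\<zero>\<^bsub>M\<^esub> = cls 0" using h.hom_zero by (simp add: quot_module_def poly_ring_simps(3))
    then show ?case by (simp only: Mm.finsum_empty sum.empty)
  next
    case (insert a A)
    have "finsum M (\<lambda>i. cls (p i)) (insert a A) = cls (p a) \<oplus>\<^bsub>M\<^esub> finsum M (\<lambda>i. cls (p i)) A"
      using insert by (intro Mm.finsum_insert) (auto simp: carrier_M)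
    also have "\<dots> = cls (p a) \<oplus>\<^bsub>M\<^esub> cls (sum p A)" using insert by simp
    also have "\<dots> = cls (p a + sum p A)"
      using h.hom_add[of "p a" "sum p A"] insert.prems sum_closed[of A p]
      by (simp add: quot_module_def poly_ring_simps(1))
    finally show ?case using insert by simp
  qed
qed

text \<open>
  The submodule \<open>(f\<^sub>1, \<dots>, f\<^sub>r)M\<close> of \<open>M = S/I\<close> corresponds to the ideal \<open>I + (f\<^sub>1, \<dots>, f\<^sub>r)\<close>
  of \<open>S\<close>, so that regularity of a sequence on \<open>M\<close> becomes a statement about ideals of \<open>S\<close>.
\<close>

lemma cls_mem_ideal_smult_iff:
  assumes "set fs \<subseteq> S" "p \<in> S"
  shows "cls p \<in> ideal_smult M fs \<longleftrightarrow> p \<in> adjoin_list I fs"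
proof -
  have combination: "finsum M (\<lambda>i. fs ! i \<odot>\<^bsub>M\<^esub> cls (s i)) {..<length fs} = cls (\<Sum>i<length fs. fs ! i * s i)"
    and closed: "(\<Sum>i<length fs. fs ! i * s i) \<in> S"
    if s: "s \<in> {..<length fs} \<rightarrow> S" for s
  proof -
    interpret Mm: Module.module "poly_ring X" M
      by (rule quot_module_module[OF poly_ring_cring ideal_I])
    have in_S: "fs ! i \<in> S" "s i \<in> S" "fs ! i * s i \<in> S" if "i < length fs" for i
    proof -
      show fi: "fs ! i \<in> S" using assms(1) nth_mem[OF that] by blast
      show si: "s i \<in> S" using s that by blast
      show "fs ! i * s i \<in> S" by (rule mult_closed[OF fi si])
    qed
    have "finsum M (\<lambda>i. fs ! i \<odot>\<^bsub>M\<^esub> cls (s i)) {..<length fs} = finsum M (\<lambda>i. cls (fs ! i * s i)) {..<length fs}"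
      using in_S by (intro Mm.finsum_cong') (auto simp: smult_cls carrier_M)
    then show "finsum M (\<lambda>i. fs ! i \<odot>\<^bsub>M\<^esub> cls (s i)) {..<length fs} = cls (\<Sum>i<length fs. fs ! i * s i)"
      using in_S finsum_cls[of "{..<length fs}" "\<lambda>i. fs ! i * s i"] by simp
    show "(\<Sum>i<length fs. fs ! i * s i) \<in> S"
      using in_S by (intro sum_closed) auto
  qed
  have "cls p \<in> ideal_smult M fs \<longleftrightarrow>
      (\<exists>s \<in> {..<length fs} \<rightarrow> S. cls p = finsum M (\<lambda>i. fs ! i \<odot>\<^bsub>M\<^esub> cls (s i)) {..<length fs})"
  proof
    assume "cls p \<in> ideal_smult M fs"
    then obtain x where x: "x \<in> {..<length fs} \<rightarrow> cls ` S"
      "cls p = finsum M (\<lambda>i. fs ! i \<odot>\<^bsub>M\<^esub> x i) {..<length fs}"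
      by (auto simp: ideal_smult_def carrier_M)
    then have "\<forall>i \<in> {..<length fs}. \<exists>s. s \<in> S \<and> x i = cls s" by blast
    then obtain s where s: "\<forall>i \<in> {..<length fs}. s i \<in> S \<and> x i = cls (s i)" by metis
    interpret Mm: Module.module "poly_ring X" M
      by (rule quot_module_module[OF poly_ring_cring ideal_I])
    have "finsum M (\<lambda>i. fs ! i \<odot>\<^bsub>M\<^esub> x i) {..<length fs} = finsum M (\<lambda>i. fs ! i \<odot>\<^bsub>M\<^esub> cls (s i)) {..<length fs}"
    proof (rule Mm.finsum_cong')
      show "(\<lambda>i. fs ! i \<odot>\<^bsub>M\<^esub> cls (s i)) \<in> {..<length fs} \<rightarrow> carrier M"
        using s assms(1) nth_mem by (intro funcsetI Mm.smult_closed) (auto simp: carrier_M)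
    qed (use s in auto)
    with x s show "\<exists>s \<in> {..<length fs} \<rightarrow> S. cls p = finsum M (\<lambda>i. fs ! i \<odot>\<^bsub>M\<^esub> cls (s i)) {..<length fs}"
      by (intro bexI[of _ s]) auto
  next
    assume "\<exists>s \<in> {..<length fs} \<rightarrow> S. cls p = finsum M (\<lambda>i. fs ! i \<odot>\<^bsub>M\<^esub> cls (s i)) {..<length fs}"
    then obtain s where "s \<in> {..<length fs} \<rightarrow> S"
      "cls p = finsum M (\<lambda>i. fs ! i \<odot>\<^bsub>M\<^esub> cls (s i)) {..<length fs}" by blast
    then show "cls p \<in> ideal_smult M fs"
      unfolding ideal_smult_def mem_Collect_eq
      by (intro exI[of _ "\<lambda>i. cls (s i)"]) (auto simp: carrier_M)
  qed
  also have "\<dots> \<longleftrightarrow> (\<exists>s \<in> {..<length fs} \<rightarrow> S. p - (\<Sum>i<length fs. fs ! i * s i) \<in> I)"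
    using combination closed cls_eq_iff[OF assms(2)] by (intro bex_cong) simp_all
  also have "\<dots> \<longleftrightarrow> p \<in> adjoin_list I fs"
    using adjoin_list_explicit[OF assms(2,1)] by simp
  finally show ?thesis .
qed

lemma weakly_regular_if_regular_sequence:
  assumes "regular_sequence (poly_ring X) M fs"
  shows "weakly_regular I fs"
  unfolding weakly_regular_iff_nth
proof (intro allI impI ballI)
  fix i x assume i: "i < length fs" and x: "x \<in> S" and fx: "fs ! i * x \<in> adjoin_list I (take i fs)"
  have fs: "set fs \<subseteq> S" using assms by (simp add: regular_sequence_def)
  then have take: "set (take i fs) \<subseteq> S" using set_take_subset by fast
  have fi: "fs ! i \<in> S" using fs i nth_mem by blast
  have "fs ! i \<odot>\<^bsub>M\<^esub> cls x \<in> ideal_smult M (take i fs)"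
    unfolding smult_cls[OF fi x] using cls_mem_ideal_smult_iff[OF take mult_closed[OF fi x]] fx by blast
  then have "cls x \<in> ideal_smult M (take i fs)"
    using assms i x unfolding regular_sequence_def carrier_M by blast
  then show "x \<in> adjoin_list I (take i fs)"
    using cls_mem_ideal_smult_iff[OF take x] by blast
qed

end

section \<open>A monomial annihilated by the variables outside a set\<close>

text \<open>
  The class of the monomial \<open>x\<^sup>u\<close> in \<open>S/I\<close> is nonzero and is annihilated by the prime ideal generated
  by the variables outside \<open>D\<close>.  The hypothesis that \<open>x\<^sup>u\<close> occurs in no element of \<open>I\<close> amounts
  to \<open>x\<^sup>u \<notin> I\<close> for a monomial ideal.
\<close>

locale monomial_annihilated_by_variables = poly_quotient +
  fixes D :: "'a set" and u :: "'a \<Rightarrow>\<^sub>0 nat"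
  assumes finite_X: "finite X" and D_subset: "D \<subseteq> X" and keys_u: "Poly_Mapping.keys u \<subseteq> X"
    and u_notin: "p \<in> I \<Longrightarrow> u \<notin> Poly_Mapping.keys p"
    and annihilated: "p \<in> carrier (poly_ring X) \<Longrightarrow> (\<And>t. t \<in> Poly_Mapping.keys p \<Longrightarrow> \<not> Poly_Mapping.keys t \<subseteq> D) \<Longrightarrow>
      p * Poly_Mapping.single u 1 \<in> I"
begin

lemma single_u_closed: "Poly_Mapping.single u 1 \<in> S"
  using keys_u by (simp add: poly_ring_simps)

lemma mem_keys_sum:
  assumes "Poly_Mapping.single u 1 - sum g A \<in> I"
  obtains i where "i \<in> A" "u \<in> Poly_Mapping.keys (g i)"
proof -
  have "u \<notin> Poly_Mapping.keys (Poly_Mapping.single u 1 - sum g A)"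
    using u_notin[OF assms] .
  then have "Poly_Mapping.lookup (sum g A) u = 1"
    by (simp add: in_keys_iff lookup_minus)
  then have "u \<in> Poly_Mapping.keys (sum g A)"
    by (simp add: in_keys_iff)
  then show thesis using keys_sum[of g A] that by blast
qed

text \<open>
  A regular sequence longer than \<open>card D\<close> stays weakly regular when its elements are raised to the
  power \<open>k = deg x\<^sup>u + 1\<close>.  By counting, the powers satisfy a \<open>K\<close>-relation modulo the
  variables outside \<open>D\<close>, which therefore annihilates the class of \<open>x\<^sup>u\<close>.  So \<open>x\<^sup>u\<close> lies in
  the ideal generated by \<open>I\<close> and the powers.  This is impossible: \<open>x\<^sup>u\<close> occurs in no
  element of \<open>I\<close>, and all terms of multiples of the powers have degree at least \<open>k\<close>.
\<close>

lemma depth_le: "depth (poly_ring X) (max_ideal X) M \<le> enat (card D)"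
  unfolding depth_def
proof (rule SUP_least, clarify)
  fix fs :: "('a, 'b) mpoly list"
  assume max: "set fs \<subseteq> max_ideal X" and reg: "regular_sequence (poly_ring X) M fs"
  have "length fs \<le> card D"
  proof (rule ccontr)
    assume "\<not> length fs \<le> card D"
    define k where "k = Suc (tdeg X u)"
    define gs where "gs = map (\<lambda>f. f ^ k) fs"
    have fs: "set fs \<subseteq> S" using reg by (simp add: regular_sequence_def)
    then have gs: "set gs \<subseteq> S" using power_closed by (auto simp: gs_def)
    have wreg: "weakly_regular I gs"
      unfolding gs_def k_def
      by (intro weakly_regular_powers is_ideal_I fs weakly_regular_if_regular_sequence reg)
    have "finite D" using D_subset finite_X finite_subset by blast
    moreover have "card D < length gs" using \<open>\<not> length fs \<le> card D\<close> by (simp add: gs_def)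
    ultimately obtain F c where F: "finite F" "F \<noteq> {}"
      and c: "\<And>\<alpha>. \<alpha> \<in> F \<Longrightarrow> length \<alpha> = length gs \<and> c \<alpha> \<noteq> 0"
      and rel: "\<And>t. t \<in> Poly_Mapping.keys (\<Sum>\<alpha> \<in> F. Poly_Mapping.single 0 (c \<alpha>) * monomial_value gs \<alpha>) \<Longrightarrow>
        \<not> Poly_Mapping.keys t \<subseteq> D"
      by (rule polynomial_relation) blast
    have const: "Poly_Mapping.single 0 a \<in> S" for a :: 'b
      by (simp add: poly_ring_simps)
    have "(\<Sum>\<alpha> \<in> F. Poly_Mapping.single 0 (c \<alpha>) * monomial_value gs \<alpha>) * Poly_Mapping.single u 1 \<in> I"
      using rel gs by (intro annihilated sum_closed mult_closed const monomial_value_closed)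
    then have "Poly_Mapping.single u 1 \<in> adjoin_list I gs"
    proof (intro relation_imp_mem_adjoin_list[OF is_ideal_I gs wreg single_u_closed F(1),
          where c = "\<lambda>\<alpha>. Poly_Mapping.single 0 (c \<alpha>)"])
      show "\<exists>d \<in> S. d * Poly_Mapping.single 0 (c \<alpha>) = 1" if "\<alpha> \<in> F" for \<alpha>
        using c[OF that] by (intro bexI[of _ "Poly_Mapping.single 0 (inverse (c \<alpha>))"] const)
          (simp add: mult_single)
    qed (use F(2) c const in auto)
    then obtain s where s: "s \<in> {..<length gs} \<rightarrow> S"
        "Poly_Mapping.single u 1 - (\<Sum>i<length gs. gs ! i * s i) \<in> I"
      using adjoin_list_explicit[OF single_u_closed gs] by blast
    then obtain i where i: "i < length gs" "u \<in> Poly_Mapping.keys (gs ! i * s i)"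
      by (auto elim: mem_keys_sum)
    then obtain a b where ab: "u = a + b" "a \<in> Poly_Mapping.keys (gs ! i)"
      using keys_mult[of "gs ! i" "s i"] by blast
    have "a \<in> Poly_Mapping.keys ((fs ! i) ^ k)" using ab(2) i(1) by (simp add: gs_def)
    moreover have "fs ! i \<in> max_ideal X" using max i(1) by (auto simp: gs_def)
    ultimately have "k \<le> tdeg X a" using tdeg_power[OF finite_X] by blast
    then show False by (simp add: k_def ab(1) tdeg_add)
  qed
  then show "enat (length fs) \<le> enat (card D)" by simp
qed

text \<open>
  Some Stanley space \<open>wK[A]\<close> contributes to \<open>x\<^sup>u\<close>.  Its generator is homogeneous, hence the
  class of a scalar multiple of a monomial \<open>x\<^sup>t\<close>, and \<open>x\<^sup>u = x\<^sup>s x\<^sup>t\<close> with \<open>x\<^sup>s \<in> K[A]\<close>.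
  If \<open>A\<close> had more than \<open>card D\<close> elements, then it would contain a variable \<open>y \<notin> D\<close>; as \<open>y\<close>
  annihilates the class of \<open>x\<^sup>u\<close>, the nonzero element \<open>y x\<^sup>s\<close> of \<open>K[A]\<close> would kill \<open>w\<close>,
  against freeness.
\<close>

lemma sdepth_le: "sdepth X M (quot_grading X I) \<le> enat (card D)"
  unfolding sdepth_def
proof (rule SUP_least, clarify)
  fix ds assume dec: "stanley_decomposition X M (quot_grading X I) ds"
  let ?A = "\<lambda>i. snd (ds ! i)"
  have piece: "\<exists>r \<in> S. \<exists>a. fst (ds ! i) = cls r \<and> (\<forall>t \<in> Poly_Mapping.keys r. \<forall>v. int (Poly_Mapping.lookup t v) = a v)"
    and A: "?A i \<subseteq> X" and inj: "inj_on (\<lambda>f. f \<odot>\<^bsub>M\<^esub> fst (ds ! i)) (carrier (poly_ring (?A i)))"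
    if "i < length ds" for i
  proof -
    have "ds ! i \<in> set ds" using that by simp
    then have *: "homogeneous_elem (quot_grading X I) (fst (ds ! i)) \<and> ?A i \<subseteq> X \<and>
        inj_on (\<lambda>f. f \<odot>\<^bsub>M\<^esub> fst (ds ! i)) (carrier (poly_ring (?A i)))"
      using dec unfolding stanley_decomposition_def by fastforce
    then show "?A i \<subseteq> X" "inj_on (\<lambda>f. f \<odot>\<^bsub>M\<^esub> fst (ds ! i)) (carrier (poly_ring (?A i)))" by auto
    from * show "\<exists>r \<in> S. \<exists>a. fst (ds ! i) = cls r \<and> (\<forall>t \<in> Poly_Mapping.keys r. \<forall>v. int (Poly_Mapping.lookup t v) = a v)"
      unfolding homogeneous_elem_def quot_grading_def cls_def by blast
  qed
  from piece obtain r a where r: "\<And>i. i < length ds \<Longrightarrow> r i \<in> S"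
    "\<And>i. i < length ds \<Longrightarrow> fst (ds ! i) = cls (r i)"
    and hom: "\<And>i t v. i < length ds \<Longrightarrow> t \<in> Poly_Mapping.keys (r i) \<Longrightarrow> int (Poly_Mapping.lookup t v) = a i v"
    by metis
  have sub: "carrier (poly_ring (?A i)) \<subseteq> S" if "i < length ds" for i
    using A[OF that] by (fastforce simp: poly_ring_simps)
  have "cls (Poly_Mapping.single u 1) \<in> carrier M" using single_u_closed carrier_M by blast
  then have "\<exists>!y. y \<in> (\<Pi>\<^sub>E i \<in> {..<length ds}. stanley_space M (ds ! i)) \<and>
      cls (Poly_Mapping.single u 1) = finsum M y {..<length ds}"
    using dec unfolding stanley_decomposition_def by (elim conjE) (rule bspec)
  then obtain y where y: "y \<in> (\<Pi>\<^sub>E i \<in> {..<length ds}. stanley_space M (ds ! i))"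
      "cls (Poly_Mapping.single u 1) = finsum M y {..<length ds}"
    by (elim ex1E conjE) (rule that)
  have "\<exists>f \<in> carrier (poly_ring (?A i)). y i = f \<odot>\<^bsub>M\<^esub> cls (r i)" if i: "i < length ds" for i
  proof -
    have "y i \<in> stanley_space M (ds ! i)" using y(1) i by auto
    then show ?thesis
      unfolding stanley_space_def using r(2)[OF i] by (auto split: prod.splits simp: case_prod_beta)
  qed
  then obtain f where f: "\<And>i. i < length ds \<Longrightarrow> f i \<in> carrier (poly_ring (?A i))"
    "\<And>i. i < length ds \<Longrightarrow> y i = f i \<odot>\<^bsub>M\<^esub> cls (r i)"
    by metis
  have fS: "f i \<in> S" "f i * r i \<in> S" if "i < length ds" for i
    using f(1) r(1) sub that mult_closed by blast+
  interpret Mm: Module.module "poly_ring X" M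
    by (rule quot_module_module[OF poly_ring_cring ideal_I])
  have "finsum M y {..<length ds} = finsum M (\<lambda>i. cls (f i * r i)) {..<length ds}"
    using fS f(2) r(1) by (intro Mm.finsum_cong') (auto simp: smult_cls carrier_M)
  also have "\<dots> = cls (\<Sum>i<length ds. f i * r i)"
    using fS by (intro finsum_cls) auto
  finally have "Poly_Mapping.single u 1 - (\<Sum>i<length ds. f i * r i) \<in> I"
    using y(2) cls_eq_iff[OF single_u_closed, of "\<Sum>i<length ds. f i * r i"]
      sum_closed[of "{..<length ds}" "\<lambda>i. f i * r i"] fS by simp
  then obtain i where i: "i < length ds" "u \<in> Poly_Mapping.keys (f i * r i)"
    by (auto elim: mem_keys_sum)
  then obtain s t where st: "u = s + t" "s \<in> Poly_Mapping.keys (f i)" "t \<in> Poly_Mapping.keys (r i)"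
    using keys_mult[of "f i" "r i"] by blast
  have "card (?A i) \<le> card D"
  proof (rule ccontr)
    assume "\<not> card (?A i) \<le> card D"
    moreover have "finite D" using D_subset finite_X finite_subset by blast
    ultimately have "\<not> ?A i \<subseteq> D" using card_mono by blast
    then obtain x where x: "x \<in> ?A i" "x \<notin> D" by blast
    define c where "c = Poly_Mapping.lookup (r i) t"
    define g :: "('a, 'b) mpoly" where "g = Poly_Mapping.single (Poly_Mapping.single x 1 + s) 1"
    have "Poly_Mapping.keys (r i) = {t}"
    proof -
      have "t' = t" if "t' \<in> Poly_Mapping.keys (r i)" for t'
        using hom[OF i(1) that] hom[OF i(1) st(3)] by (intro poly_mapping_eqI) (metis of_nat_eq_iff)
      then show ?thesis using st(3) by blast
    qed
    then have ri: "r i = Poly_Mapping.single t c"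
      using sum_single_lookup[of "r i"] by (simp add: c_def)
    have gA: "g \<in> carrier (poly_ring (?A i))"
      using f(1)[OF i(1)] st(2) x(1) by (auto simp: g_def poly_ring_simps keys_add_nat)
    then have gS: "g \<in> S" using sub i(1) by blast
    have "g * r i = Poly_Mapping.single (Poly_Mapping.single x 1) c * Poly_Mapping.single u 1"
      by (simp add: g_def ri mult_single st(1) add.assoc)
    also have "\<dots> \<in> I"
      using x A[OF i(1)] by (intro annihilated) (auto simp: poly_ring_simps split: if_splits)
    finally have "cls (g * r i) = cls (0 * r i)"
      using cls_eq_iff[of "g * r i" 0] mult_closed[OF gS r(1)[OF i(1)]] zero_closed by simp
    then have "g \<odot>\<^bsub>M\<^esub> fst (ds ! i) = 0 \<odot>\<^bsub>M\<^esub> fst (ds ! i)"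
      using r[OF i(1)] gS zero_closed by (simp add: smult_cls)
    moreover have "(0 :: ('a, 'b) mpoly) \<in> carrier (poly_ring (?A i))"
      by (simp add: poly_ring_simps)
    ultimately have "g = 0" using inj_onD[OF inj[OF i(1)]] gA by blast
    then show False by (simp add: g_def flip: keys_eq_empty)
  qed
  moreover have "sdepth_decomposition ds \<le> enat (card (?A i))"
    unfolding sdepth_decomposition_def using i(1)
    by (intro INF_lower2[of "ds ! i"]) (auto simp: case_prod_beta)
  ultimately show "sdepth_decomposition ds \<le> enat (card D)"
    by (meson enat_ord_simps(1) order_trans)
qed

end

section \<open>Independent dominating sets and the grid\<close>

text \<open>
  The product \<open>x\<^sup>u\<close> of the vertices of \<open>D\<close> is not in the edge ideal because \<open>D\<close> is
  independent, and each variable outside \<open>D\<close> annihilates it modulo the edge ideal because \<open>D\<close> is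
  dominating.
\<close>

theorem depth_sdepth_le_independent_dominating_set:
  fixes G :: "'v pair_pre_digraph"
  assumes G: "pair_graph G" and D: "D \<subseteq> pverts G"
    and independent: "\<And>v w. v \<in> D \<Longrightarrow> w \<in> D \<Longrightarrow> (v, w) \<notin> parcs G"
    and dominating: "\<And>w. w \<in> pverts G \<Longrightarrow> w \<notin> D \<Longrightarrow> \<exists>v \<in> D. (v, w) \<in> parcs G"
  defines "I \<equiv> edge_ideal G :: ('v, 'k::field) mpoly set"
  shows "depth (poly_ring (pverts G)) (max_ideal (pverts G)) (quot_module (poly_ring (pverts G)) I)
      \<le> enat (card D)"
    and "sdepth (pverts G) (quot_module (poly_ring (pverts G)) I) (quot_grading (pverts G) I)
      \<le> enat (card D)"
proof -
  interpret G: pair_graph G by fact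
  have fin: "finite D" using D G.pair_finite_verts finite_subset by blast
  define u where "u = (\<Sum>v \<in> D. Poly_Mapping.single v (1 :: nat))"
  have "Poly_Mapping.lookup u w = (if w \<in> D then 1 else 0)" for w
    using fin by (simp add: u_def lookup_sum lookup_single when_def)
  then have keys_u: "Poly_Mapping.keys u = D"
    by (auto simp: in_keys_iff split: if_splits)
  interpret monomial_annihilated_by_variables "pverts G" I D u
  proof (intro monomial_annihilated_by_variables.intro poly_quotient.intro
      monomial_annihilated_by_variables_axioms.intro)
    show "ideal I (poly_ring (pverts G))" unfolding I_def by (rule edge_ideal_ideal[OF G])
    show "finite (pverts G)" "D \<subseteq> pverts G" "Poly_Mapping.keys u \<subseteq> pverts G"
      using D keys_u by auto
    show "u \<notin> Poly_Mapping.keys p" if "p \<in> I" for p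
      using that independent by (auto simp: I_def mem_edge_ideal_iff[OF G] keys_u)
    fix p :: "('v, 'k) mpoly"
    assume p: "p \<in> carrier (poly_ring (pverts G))"
      "\<And>t. t \<in> Poly_Mapping.keys p \<Longrightarrow> \<not> Poly_Mapping.keys t \<subseteq> D"
    interpret subring_of_type "carrier (poly_ring (pverts G) :: ('v, 'k) mpoly ring)"
      by (rule subring_poly_ring)
    have "p * Poly_Mapping.single u 1 \<in> carrier (poly_ring (pverts G))"
      using p(1) D keys_u by (intro mult_closed) (auto simp: poly_ring_simps)
    moreover have "\<exists>(v, w) \<in> parcs G. v \<in> Poly_Mapping.keys t' \<and> w \<in> Poly_Mapping.keys t'"
      if t': "t' \<in> Poly_Mapping.keys (p * Poly_Mapping.single u 1)" for t'
    proof -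
      obtain t where t: "t \<in> Poly_Mapping.keys p" "t' = t + u"
        using t' keys_mult[of p "Poly_Mapping.single u 1"] by auto
      then obtain w where w: "w \<in> Poly_Mapping.keys t" "w \<notin> D" using p(2) by blast
      then have "w \<in> pverts G" using p(1) t(1) by (auto simp: poly_ring_simps)
      then obtain v where "v \<in> D" "(v, w) \<in> parcs G" using dominating w(2) by blast
      then show ?thesis using w(1) by (auto simp: t(2) keys_add_nat keys_u)
    qed
    ultimately show "p * Poly_Mapping.single u 1 \<in> I"
      by (simp add: I_def mem_edge_ideal_iff[OF G])
  qed
  show "depth (poly_ring (pverts G)) (max_ideal (pverts G)) (quot_module (poly_ring (pverts G)) I)
      \<le> enat (card D)"
    by (rule depth_le)
  show "sdepth (pverts G) (quot_module (poly_ring (pverts G)) I) (quot_grading (pverts G) I)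
      \<le> enat (card D)"
    by (rule sdepth_le)
qed

text \<open>
  The vertices \<open>2, 5, 8, \<dots>\<close> of the path.  The minimum with \<open>n\<close> matters only when \<open>n\<close> leaves
  remainder 1 modulo 3: the last vertex then serves as a center of its own, at distance 2 from the
  preceding one, if there is one.
\<close>

definition path_centers :: "nat \<Rightarrow> nat set" where
  "path_centers n = (\<lambda>a. min (3 * a + 2) n) ` {..<(n + 2) div 3}"

lemma nat_ceiling_div_3: "nat \<lceil>real n / 3\<rceil> = (n + 2) div 3"
proof -
  define q where "q = (n + 2) div 3"
  have "3 * q \<le> n + 2" "n \<le> 3 * q" unfolding q_def by presburger+
  then have "real (3 * q) \<le> real (n + 2)" "real n \<le> real (3 * q)" by (simp_all only: of_nat_le_iff)
  then have "\<lceil>real n / 3\<rceil> = int ((n + 2) div 3)"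
    unfolding q_def[symmetric] by (intro ceiling_unique) simp_all
  then show ?thesis by simp
qed

lemma path_centers_subset: "path_centers n \<subseteq> {1..n}"
  by (auto simp: path_centers_def)

lemma path_centers_separated:
  assumes "i \<in> path_centers n" "k \<in> path_centers n" "\<bar>int i - int k\<bar> \<le> 1"
  shows "i = k"
proof -
  obtain a b where ab: "i = min (3 * a + 2) n" "k = min (3 * b + 2) n"
      "a < (n + 2) div 3" "b < (n + 2) div 3"
    using assms by (auto simp: path_centers_def)
  have "3 * a + 1 \<le> n" "3 * b + 1 \<le> n" using ab(3,4) by presburger+
  then show ?thesis
    using ab(1,2) assms(3) by (cases a b rule: linorder_cases) (auto simp: min_def split: if_splits)
qed

lemma path_centers_dominating:
  assumes "i \<in> {1..n}"
  obtains k where "k \<in> path_centers n" "\<bar>int k - int i\<bar> \<le> 1"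
proof (rule that)
  show "min (3 * ((i - 1) div 3) + 2) n \<in> path_centers n"
    \<comment> \<open>The vertex \<open>i\<close> lies in the block \<open>{3a + 1, 3a + 2, 3a + 3}\<close> with \<open>a = (i - 1) div 3\<close>.\<close>
    unfolding path_centers_def using assms by (intro imageI) auto
  show "\<bar>int (min (3 * ((i - 1) div 3) + 2) n) - int i\<bar> \<le> 1"
    using assms by (auto simp: min_def)
qed

lemma card_path_centers: "card (path_centers n) = (n + 2) div 3"
proof -
  have "inj_on (\<lambda>a. min (3 * a + 2) n) {..<(n + 2) div 3}"
    by (auto simp: inj_on_def min_def split: if_splits)
  then show ?thesis by (simp add: path_centers_def card_image)
qed

theorem theorem5p2:
  fixes n m :: nat
    and G :: "(nat \<times> nat) pair_pre_digraph"
    and S :: "(nat \<times> nat, 'k::field) mpoly ring"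
    and M :: "((nat \<times> nat, 'k) mpoly, (nat \<times> nat, 'k) mpoly set) module"
  assumes "n \<ge> 2" and "m \<ge> 1"
    and "G = path_graph n \<boxtimes> path_graph m"
    and "S = poly_ring (pverts G)"
    and "M = quot_module S (edge_ideal G)"
  shows "depth S (max_ideal (pverts G)) M \<le> enat (nat \<lceil>real n / 3\<rceil> * nat \<lceil>real m / 3\<rceil>) \<and>
    sdepth (pverts G) M (quot_grading (pverts G) (edge_ideal G))
      \<le> enat (nat \<lceil>real n / 3\<rceil> * nat \<lceil>real m / 3\<rceil>)"
proof -
  define D where "D = path_centers n \<times> path_centers m"
  have G: "pair_graph G"
    unfolding assms(3) by (intro pair_graph_strong_product pair_graph_path_graph)
  have verts: "pverts G = {1..n} \<times> {1..m}"
    by (simp add: assms(3) strong_product_def path_graph_def)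
  have arcs: "((i, j), (k, l)) \<in> parcs G \<longleftrightarrow> (i, j) \<in> pverts G \<and> (k, l) \<in> pverts G \<and> (i, j) \<noteq> (k, l) \<and>
      \<bar>int i - int k\<bar> \<le> 1 \<and> \<bar>int j - int l\<bar> \<le> 1" for i j k l
    unfolding verts unfolding assms(3) by (rule parcs_strong_product_path_graph)
  have D: "D \<subseteq> pverts G"
    using path_centers_subset unfolding D_def verts by blast
  have independent: "(v, w) \<notin> parcs G" if "v \<in> D" "w \<in> D" for v w
    using that path_centers_separated by (cases v; cases w) (auto simp: D_def arcs)
  have dominating: "\<exists>v \<in> D. (v, w) \<in> parcs G" if w: "w \<in> pverts G" "w \<notin> D" for w
  proof -
    obtain i j where ij: "w = (i, j)" "i \<in> {1..n}" "j \<in> {1..m}" using w(1) verts by auto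
    obtain k l where kl: "k \<in> path_centers n" "\<bar>int k - int i\<bar> \<le> 1" "l \<in> path_centers m" "\<bar>int l - int j\<bar> \<le> 1"
      using path_centers_dominating[OF ij(2)] path_centers_dominating[OF ij(3)] by metis
    then have "(k, l) \<in> D" by (simp add: D_def)
    then show ?thesis
      using w kl D by (intro bexI[of _ "(k, l)"]) (auto simp: ij(1) arcs)
  qed
  have card: "card D = nat \<lceil>real n / 3\<rceil> * nat \<lceil>real m / 3\<rceil>"
    by (simp add: D_def card_cartesian_product card_path_centers nat_ceiling_div_3)
  show ?thesis
    using depth_sdepth_le_independent_dominating_set[OF G D independent dominating]
    unfolding assms(4,5) card by blast
qed

end
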